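(* Let $h:\mathbb{D}\to[0,\infty)$ be a continuous non-negative function on the open unit disk $\mathbb{D}$ such that $\liminf_{z\to\zeta}h(z)>0$ for each $\zeta\in\partial\mathbb{D}$. Then the family of all functions $f$ meromorphic in $\mathbb{D}$ such that $f^\#(z)\ne h(z)$ for all $z\in\mathbb{D}$ is normal in $\mathbb{D}$.
   Context: $\mathbb{D}=\{z\in\mathbb{C}:|z|<1\}$, and the limes inferior is taken over $z\in\mathbb{D}$. The spherical derivative of a meromorphic function $f$ is $f^\#:=\frac{|f'|}{1+|f|^2}$, extended continuously to the poles of $f$ (equivalently, $f^\#(z_0)=(1/f)^\#(z_0)$ at a pole $z_0$). A family $\mathcal{F}$ of meromorphic functions in a domain $D\subseteq\mathbb{C}$ is normal in $D$ (in the sense of Montel) if every sequence in $\mathcal{F}$ has a subsequence that converges locally uniformly in $D$ with respect to the spherical metric, the limit being either a meromorphic function in $D$ or identically $\infty$. *)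

theory Defs
  imports "HOL-Complex_Analysis.Complex_Analysis"
begin

text \<open>
  Meromorphic functions on an open set \<open>D\<close> are represented by functions that are
  \<open>nicely_meromorphic_on D\<close>: they are holomorphic in \<open>D\<close> away from their poles, removable
  singularities are filled in, and the (irrelevant) value at a pole is \<open>0\<close>.
  The Riemann sphere is \<open>complex option\<close>, where \<open>None\<close> is the point at infinity.
\<close>

definition sphere_val :: "(complex \<Rightarrow> complex) \<Rightarrow> complex \<Rightarrow> complex option" where
  "sphere_val f z = (if is_pole f z then None else Some (f z))"

fun chordal_dist :: "complex option \<Rightarrow> complex option \<Rightarrow> real" where
  "chordal_dist (Some z) (Some w) =
     norm (z - w) / (sqrt (1 + (norm z)\<^sup>2) * sqrt (1 + (norm w)\<^sup>2))"
| "chordal_dist (Some z) None = 1 / sqrt (1 + (norm z)\<^sup>2)"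
| "chordal_dist None (Some w) = 1 / sqrt (1 + (norm w)\<^sup>2)"
| "chordal_dist None None = 0"

text \<open>
  The geodesic distance of the line element \<open>|dz| / (1 + |z|\<^sup>2)\<close>, that is, the
  great-circle distance on the sphere of diameter \<open>1\<close>, on which an arc of length \<open>s\<close> (with
  \<open>s \<le> \<pi>/2\<close>) has a chord of length \<open>sin s\<close>.
\<close>

definition spherical_dist :: "complex option \<Rightarrow> complex option \<Rightarrow> real" where
  "spherical_dist p q = arcsin (chordal_dist p q)"

definition locally_uniform_spherical_limit ::
    "complex set \<Rightarrow> (nat \<Rightarrow> complex \<Rightarrow> complex option) \<Rightarrow> (complex \<Rightarrow> complex option) \<Rightarrow> bool" where
  "locally_uniform_spherical_limit D s g \<longleftrightarrow>
     (\<forall>z\<in>D. \<exists>U. open U \<and> z \<in> U \<and>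
        (\<forall>e>0. \<forall>\<^sub>F n in sequentially. \<forall>w\<in>U \<inter> D. spherical_dist (s n w) (g w) < e))"

definition normal_family_on :: "(complex \<Rightarrow> complex) set \<Rightarrow> complex set \<Rightarrow> bool" where
  "normal_family_on F D \<longleftrightarrow>
     (\<forall>s. (\<forall>n. s n \<in> F) \<longrightarrow>
        (\<exists>(r :: nat \<Rightarrow> nat) g. strict_mono r \<and>
           locally_uniform_spherical_limit D (\<lambda>n. sphere_val (s (r n))) g \<and>
           ((\<exists>\<phi>. \<phi> nicely_meromorphic_on D \<and> (\<forall>z\<in>D. g z = sphere_val \<phi> z)) \<or>
            (\<forall>z\<in>D. g z = None))))"

text \<open>At a pole this is the continuous extension of the formula for regular points.\<close>

definition spherical_deriv :: "(complex \<Rightarrow> complex) \<Rightarrow> complex \<Rightarrow> real" where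
  "spherical_deriv f z =
     (if is_pole f z then Lim (at z) (\<lambda>w. norm (deriv f w) / (1 + (norm (f w))\<^sup>2))
      else norm (deriv f z) / (1 + (norm (f z))\<^sup>2))"

lemma chordal_dist_bounds: "0 \<le> chordal_dist p q" "chordal_dist p q \<le> 1"
proof -
  have ge: "1 \<le> sqrt (1 + (norm z)\<^sup>2)" for z :: complex
    by simp
  have *: "norm (z - w) \<le> sqrt (1 + (norm z)\<^sup>2) * sqrt (1 + (norm w)\<^sup>2)" for z w :: complex
  proof -
    have "norm (z - w) \<le> norm z + norm w"
      by (rule norm_triangle_ineq4)
    also have "\<dots> \<le> sqrt ((1 + (norm z)\<^sup>2) * (1 + (norm w)\<^sup>2))"
    proof (rule real_le_rsqrt)
      have "(1 + (norm z)\<^sup>2) * (1 + (norm w)\<^sup>2) - (norm z + norm w)\<^sup>2 = (1 - norm z * norm w)\<^sup>2"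
        by (simp add: power2_eq_square algebra_simps)
      then show "(norm z + norm w)\<^sup>2 \<le> (1 + (norm z)\<^sup>2) * (1 + (norm w)\<^sup>2)"
        by (metis diff_ge_0_iff_ge zero_le_power2)
    qed
    finally show ?thesis by (simp add: real_sqrt_mult)
  qed
  have pos: "0 < sqrt (1 + (norm z)\<^sup>2) * sqrt (1 + (norm w)\<^sup>2)" for z w :: complex
    using ge[of z] ge[of w] by (intro mult_pos_pos) linarith+
  show "0 \<le> chordal_dist p q"
    by (cases p; cases q) auto
  show "chordal_dist p q \<le> 1"
    by (cases p; cases q) (use * pos ge in \<open>auto simp: divide_le_eq_1 not_less sum_power2_le_zero_iff add_pos_nonneg\<close>)
qed

lemma spherical_deriv_pole:
  assumes f: "f nicely_meromorphic_on D" and D: "open D" "z \<in> D" and pole: "is_pole f z"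
  shows "spherical_deriv f z = spherical_deriv (\<lambda>w. inverse (f w)) z"
proof -
  define g where "g = (\<lambda>w. inverse (f w))"
  have mero: "f meromorphic_on {z}"
    using f D by (auto simp: nicely_meromorphic_on_def intro: meromorphic_on_subset)
  have fz: "f z = 0"
    using f D pole not_tendsto_and_filterlim_at_infinity[of "at z" f "f z"]
    by (auto simp: nicely_meromorphic_on_def is_pole_def)
  have g0: "g \<midarrow>z\<rightarrow> 0"
    using is_pole_tendsto[OF pole] by (simp add: g_def o_def)
  have "isCont g z"
    using g0 fz by (simp add: isCont_def g_def)
  moreover have "g meromorphic_on {z}"
    unfolding g_def by (intro meromorphic_intros mero)
  ultimately have ana: "g analytic_on {z}"
    by (simp add: meromorphic_at_isCont_imp_analytic)
  then have dcont: "deriv g \<midarrow>z\<rightarrow> deriv g z"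
    by (meson analytic_deriv analytic_at_imp_isCont isContD)
  have lim: "((\<lambda>w. norm (deriv g w) / (1 + (norm (g w))\<^sup>2)) \<longlongrightarrow>
      norm (deriv g z) / (1 + (norm (0::complex))\<^sup>2)) (at z)"
    by (intro tendsto_intros dcont g0) (auto simp: add_nonneg_eq_0_iff)
  have ev_nz: "\<forall>\<^sub>F w in at z. f w \<noteq> 0"
    using pole by (rule non_zero_neighbour_pole)
  have ev_ana: "\<forall>\<^sub>F w in at z. f analytic_on {w}"
    using mero meromorphic_on_isolated_singularity isolated_singularity_at_altdef by blast
  have "\<forall>\<^sub>F w in at z. norm (deriv g w) / (1 + (norm (g w))\<^sup>2) =
      norm (deriv f w) / (1 + (norm (f w))\<^sup>2)"
    using ev_nz ev_ana
  proof eventually_elim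
    case (elim w)
    then have "(f has_field_derivative deriv f w) (at w)"
      by (simp add: analytic_on_imp_differentiable_at DERIV_deriv_iff_field_differentiable)
    then have "deriv g w = - (inverse (f w) * deriv f w * inverse (f w))"
      unfolding g_def using elim by (intro DERIV_imp_deriv DERIV_inverse')
    then have d: "norm (deriv g w) = norm (deriv f w) / (norm (f w))\<^sup>2"
      by (simp add: norm_mult norm_inverse norm_divide field_simps power2_eq_square)
    have n: "norm (g w) = 1 / norm (f w)"
      by (simp add: g_def norm_divide inverse_eq_divide)
    have alg: "y / x\<^sup>2 / (1 + (1 / x)\<^sup>2) = y / (1 + x\<^sup>2)" if "x > 0" for x y :: real
    proof -
      have "x\<^sup>2 * (1 + (1 / x)\<^sup>2) = 1 + x\<^sup>2"
        using that by (simp add: field_simps)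
      then show ?thesis
        by (metis divide_divide_eq_left)
    qed
    show ?case
      unfolding d n by (rule alg) (use elim in simp)
  qed
  from Lim_transform_eventually[OF lim this]
  have "Lim (at z) (\<lambda>w. norm (deriv f w) / (1 + (norm (f w))\<^sup>2)) = norm (deriv g z)"
    by (intro tendsto_Lim) auto
  moreover have "\<not> is_pole g z"
    using g0 not_tendsto_and_filterlim_at_infinity[of "at z" g] by (auto simp: is_pole_def)
  ultimately show ?thesis
    using pole fz by (simp add: spherical_deriv_def g_def)
qed

end

theory Submission
  imports Defs
begin

text \<open>
  For a member \<open>f\<close> of the family, \<open>f\<^sup># - h\<close> is continuous and has no zero in the disk, so it has
  constant sign. It is to be shown that in either case \<open>f\<^sup>#\<close> is bounded on compact subsets
  by a constant that does not depend on \<open>f\<close>; normality then follows from Marty's criterion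
  (\<open>Marty_normality_criterion\<close>).

  If \<open>f\<^sup># < h\<close>, the bound is the maximum of \<open>h\<close> on the compact subset.

  If \<open>f\<^sup># > h\<close>, then \<open>f\<^sup>#\<close> is positive everywhere and, by the assumption on the limes inferior and
  compactness of the circle, at least some \<open>\<epsilon> > 0\<close> near the boundary. It is a surprising fact that
  a lower bound on \<open>f\<^sup>#\<close> entails an upper bound (\<open>spherical_deriv_upper_bound\<close>). Positivity of \<open>f\<^sup>#\<close>
  makes \<open>f\<close> locally injective. Formally \<open>f = w1 / w2\<close> with \<open>w2\<^sup>2 = 1 / f'\<close> and
  \<open>w1\<^sup>2 = f\<^sup>2 / f'\<close>, where \<open>w1\<close> and \<open>w2\<close> have constant Wronskian and
  \<open>1 / f\<^sup># = norm w1 ^ 2 + norm w2 ^ 2\<close>. The lower bound near the boundary thus bounds \<open>w1\<close> and \<open>w2\<close> there,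
  the maximum principle bounds them in the disk, Cauchy's inequality bounds their derivatives on
  compact subsets, and then the Wronskian prevents \<open>w1\<close> and \<open>w2\<close> from being small at the same point.
  The proof works directly with the holomorphic functions \<open>1 / f'\<close> and \<open>f\<^sup>2 / f'\<close>, which
  avoids the construction of global square roots: all that is needed of a square \<open>q\<close> is the bound of
  \<open>norm q' ^ 2\<close> by a multiple of \<open>norm q\<close>, and this holds for every bounded holomorphic function
  without simple zeros (\<open>deriv_bound_of_no_simple_zeros\<close>).
\<close>

section \<open>The spherical derivative\<close>

lemma eventually_no_pole:
  assumes "f meromorphic_on {z}"
  shows "\<forall>\<^sub>F w in at z. \<not> is_pole f w"
  using assms by (intro eventually_not_pole) (auto simp: meromorphic_at_iff)

lemma spherical_deriv_regular:
  "\<not> is_pole f z \<Longrightarrow> spherical_deriv f z = norm (deriv f z) / (1 + (norm (f z))\<^sup>2)"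
  by (simp add: spherical_deriv_def)

text \<open>
  The inversion of the sphere is an isometry, so poles can be traded for zeros. The total
  inverse with value \<open>0\<close> at \<open>0\<close> matches the convention that a nicely meromorphic function is
  \<open>0\<close> at its poles, so the identity also holds at zeros and poles, and for \<open>f = 0\<close>.
\<close>

lemma spherical_deriv_inverse:
  assumes f: "f nicely_meromorphic_on D" and D: "open D" "z \<in> D"
  shows "spherical_deriv (\<lambda>w. inverse (f w)) z = spherical_deriv f z"
proof (cases "is_pole f z")
  case True
  then show ?thesis using spherical_deriv_pole[OF f D] by simp
next
  case np: False
  have ana: "f analytic_on {z}"
    using f D np by (simp add: nicely_meromorphic_on_imp_analytic_at)
  show ?thesis
  proof (cases "f z = 0")
    case False
    have d: "deriv (\<lambda>w. inverse (f w)) z = - (inverse (f z) * deriv f z * inverse (f z))"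
      using ana False
      by (intro DERIV_imp_deriv DERIV_inverse')
         (auto simp: analytic_on_imp_differentiable_at DERIV_deriv_iff_field_differentiable)
    have "\<not> is_pole (\<lambda>w. inverse (f w)) z"
      using False ana by (intro analytic_at_imp_no_pole analytic_intros) auto
    moreover have "x * inverse y * inverse y / (1 + (inverse y)\<^sup>2) = x / (1 + y\<^sup>2)"
      if "y > 0" for x y :: real
    proof -
      have "1 + (inverse y)\<^sup>2 = (1 + y\<^sup>2) * (inverse y * inverse y)"
        using that by (simp add: field_simps power2_eq_square)
      moreover have "1 + y\<^sup>2 > 0" "inverse y * inverse y > 0"
        using that by (auto intro: add_pos_pos)
      ultimately show ?thesis using that by (simp add: mult.assoc)
    qed
    from this[of "norm (f z)" "norm (deriv f z)"] False
    have "norm (deriv f z) * inverse (norm (f z)) * inverse (norm (f z)) / (1 + (inverse (norm (f z)))\<^sup>2) =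
      norm (deriv f z) / (1 + (norm (f z))\<^sup>2)" by simp
    ultimately show ?thesis
      using np by (simp add: spherical_deriv_def d norm_mult norm_inverse mult_ac)
  next
    case True
    show ?thesis
    proof (cases "isolated_zero f z")
      case True
      then have "is_pole (\<lambda>w. inverse (f w)) z" by (simp add: is_pole_inverse_iff)
      from spherical_deriv_pole[OF nicely_meromorphic_on_inverse[OF f] D this] show ?thesis by simp
    next
      case False
      then have ev: "\<forall>\<^sub>F w in nhds z. f w = 0"
        using non_isolated_zero_imp_eventually_zero[OF ana \<open>f z = 0\<close>] \<open>f z = 0\<close>
        by (simp add: eventually_nhds_conv_at)
      then have ev': "\<forall>\<^sub>F w in nhds z. f w = inverse (f w)"
        by eventually_elim simp
      have "\<forall>\<^sub>F w in at z. f w = inverse (f w)"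
        using ev' by (simp add: eventually_nhds_conv_at)
      then have "is_pole (\<lambda>w. inverse (f w)) z \<longleftrightarrow> is_pole f z"
        by (intro is_pole_cong) (auto elim: eventually_mono)
      moreover have "deriv (\<lambda>w. inverse (f w)) z = deriv f z"
        using ev' by (intro deriv_cong_ev) (auto elim: eventually_mono)
      ultimately show ?thesis
        using np \<open>f z = 0\<close> by (simp add: spherical_deriv_def)
    qed
  qed
qed

lemma analytic_at_inverse_pole:
  assumes f: "f nicely_meromorphic_on D" and z: "z \<in> D" "is_pole f z"
  shows "(\<lambda>w. inverse (f w)) analytic_on {z}"
proof -
  have "isolated_zero (\<lambda>w. inverse (f w)) z"
    using z by (simp add: isolated_zero_inverse_iff)
  then show ?thesis
    using nicely_meromorphic_on_imp_analytic_at[OF nicely_meromorphic_on_inverse[OF f] z(1)]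
    pole_is_not_zero by blast
qed

text \<open>
  Near a pole of \<open>f\<close> the function \<open>1 / f\<close> is holomorphic and has the same spherical derivative.
\<close>

lemma continuous_on_spherical_deriv:
  assumes f: "f nicely_meromorphic_on D" and D: "open D"
  shows "continuous_on D (spherical_deriv f)"
proof -
  have reg: "isCont (spherical_deriv g) z" if "g analytic_on {z}" for g z
  proof -
    from that obtain U where U: "open U" "z \<in> U" "g analytic_on U"
      using analytic_at by (metis analytic_on_open)
    have "continuous_on U (\<lambda>z. norm (deriv g z) / (1 + (norm (g z))\<^sup>2))"
      using U by (intro continuous_intros holomorphic_on_imp_continuous_on holomorphic_deriv)
        (auto simp: analytic_imp_holomorphic add_nonneg_eq_0_iff)
    then have "continuous_on U (spherical_deriv g)"
      by (rule continuous_on_eq)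
        (metis U(3) analytic_at_imp_no_pole analytic_on_analytic_at spherical_deriv_regular)
    with U show ?thesis by (simp add: continuous_on_eq_continuous_at)
  qed
  have "isCont (spherical_deriv f) z" if z: "z \<in> D" for z
  proof (cases "is_pole f z")
    case False
    with f z reg show ?thesis by (simp add: nicely_meromorphic_on_imp_analytic_at)
  next
    case True
    then have "isCont (spherical_deriv (\<lambda>w. inverse (f w))) z"
      using analytic_at_inverse_pole[OF f z] reg by blast
    moreover have "\<forall>\<^sub>F w in nhds z. spherical_deriv (\<lambda>w. inverse (f w)) w = spherical_deriv f w"
      using eventually_nhds_in_open[OF D z] by eventually_elim (rule spherical_deriv_inverse[OF f D])
    ultimately show ?thesis using isCont_cong by blast
  qed
  then show ?thesis by (simp add: continuous_at_imp_continuous_on)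
qed

text \<open>
  The inverse of the zero function is again \<open>0\<close> and not \<open>\<infinity>\<close>, so \<open>\<lambda>z. inverse (f z)\<close>
  represents the sphere-valued \<open>1 / f\<close> only in the second case.
\<close>

lemma identically_zero_or_isolated_zeros:
  assumes f: "f nicely_meromorphic_on D" and D: "open D" "connected D"
  shows "(\<forall>z\<in>D. f z = 0 \<and> \<not> is_pole f z) \<or> (\<forall>z\<in>D. f z = 0 \<longrightarrow> is_pole f z \<or> isolated_zero f z)"
proof -
  consider "\<forall>z\<in>D. f z = 0" | "\<forall>\<^sub>\<approx>z\<in>D. f z \<noteq> 0"
    using nicely_meromorphic_imp_constant_or_avoid[OF f D] by blast
  then show ?thesis
  proof cases
    case 1
    have "\<not> is_pole f z" if "z \<in> D" for z
    proof -
      have "\<forall>\<^sub>F w in at z. f w = 0"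
        using eventually_at_in_open'[OF D(1) that] 1 by (auto elim: eventually_mono)
      then have "is_pole f z = is_pole (\<lambda>_. 0::complex) z" by (rule is_pole_cong) simp
      then show ?thesis by simp
    qed
    with 1 show ?thesis by blast
  next
    case 2
    then have "\<forall>\<^sub>F w in at z. f w \<noteq> 0" if "z \<in> D" for z
      using that D by (auto simp: eventually_cosparse_open_eq)
    then show ?thesis using zero_or_pole[OF f] by blast
  qed
qed

text \<open>
  A function whose spherical derivative is bounded cannot move far from its value at the centre
  of a small disk. As long as \<open>norm (f w) < 2\<close>, the ordinary derivative is at most
  \<open>5 * M\<close>, so that \<open>f\<close> stays within \<open>1 / 2\<close> of \<open>f z0\<close>; at the point nearest to \<open>z0\<close> where
  that bound breaks down, it would therefore still hold.
\<close>

lemma bounded_spherical_deriv_imp_bounded: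
  assumes f: "f nicely_meromorphic_on ball z0 \<delta>" and "\<delta> > 0"
    and M: "\<And>w. w \<in> ball z0 \<delta> \<Longrightarrow> spherical_deriv f w \<le> M" and \<delta>: "10 * M * \<delta> \<le> 1"
    and z0: "\<not> is_pole f z0" "norm (f z0) \<le> 1"
  shows "f holomorphic_on ball z0 \<delta>" "\<And>w. w \<in> ball z0 \<delta> \<Longrightarrow> norm (f w) \<le> 2"
proof -
  define good where "good w \<longleftrightarrow> \<not> is_pole f w \<and> norm (f w) < 2" for w
  have all_good: "good z" if z: "z \<in> ball z0 \<delta>" for z
  proof (rule ccontr)
    assume "\<not> good z"
    \<comment> \<open>the bad points up to the distance of z; this set is compact, hence has a point nearest to the centre\<close>
    define B where "B = {w \<in> cball z0 (dist z0 z). \<not> good w}"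
    have sub: "cball z0 (dist z0 z) \<subseteq> ball z0 \<delta>" using z by auto
    have "open {w \<in> ball z0 \<delta>. good w}"
    proof (subst open_subopen, safe)
      fix w assume w: "w \<in> ball z0 \<delta>" "good w"
      then have ana: "f analytic_on {w}"
        using f by (auto simp: good_def nicely_meromorphic_on_imp_analytic_at)
      then obtain U where "open U" "w \<in> U" "f holomorphic_on U"
        by (auto simp: analytic_at)
      then have "\<forall>\<^sub>F x in nhds w. f analytic_on {x}"
        unfolding eventually_nhds using holomorphic_on_imp_analytic_at by blast
      moreover have "\<forall>\<^sub>F x in nhds w. norm (f x) < 2"
      proof (rule order_tendstoD)
        show "((\<lambda>x. norm (f x)) \<longlongrightarrow> norm (f w)) (nhds w)"
          using analytic_at_imp_isCont[OF ana] by (intro tendsto_norm) (simp add: continuous_at tendsto_nhds_iff isCont_def)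
        qed (use w in \<open>auto simp: good_def\<close>)
      ultimately have "\<forall>\<^sub>F x in nhds w. x \<in> ball z0 \<delta> \<and> good x"
        using eventually_nhds_in_open[OF open_ball w(1)]
        by eventually_elim (auto simp: good_def dest: analytic_at_imp_no_pole)
      then show "\<exists>T. open T \<and> w \<in> T \<and> T \<subseteq> {w \<in> ball z0 \<delta>. good w}"
        by (auto simp: eventually_nhds)
    qed
    moreover have "B = cball z0 (dist z0 z) - {w \<in> ball z0 \<delta>. good w}"
      using sub by (auto simp: B_def)
    ultimately have "closed B" by (simp add: closed_Diff)
    moreover have "z \<in> B" using \<open>\<not> good z\<close> by (simp add: B_def)
    ultimately obtain y where y: "y \<in> B" "\<And>w. w \<in> B \<Longrightarrow> dist z0 y \<le> dist z0 w"
      using distance_attains_inf[of B z0] by blast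
    define R where "R = dist z0 y"
    have yD: "y \<in> ball z0 \<delta>" "\<not> good y" using y(1) sub by (auto simp: B_def)
    have "good z0" using z0 by (simp add: good_def)
    then have "R > 0" using yD by (auto simp: R_def)
    have R: "R < \<delta>" using yD by (simp add: R_def)
    have good: "good w" if "w \<in> ball z0 R" for w
    proof (rule ccontr)
      assume "\<not> good w"
      moreover have "dist z0 w < dist z0 y" "dist z0 y \<le> dist z0 z"
        using that y(1) by (auto simp: B_def R_def)
      ultimately have "w \<in> B" by (simp add: B_def)
      then show False using y(2) \<open>dist z0 w < dist z0 y\<close> by fastforce
    qed
    have "norm (f w - f z0) \<le> 5 * M * norm (w - z0)" if w: "w \<in> ball z0 R" for w
    proof (rule field_differentiable_bound[where S = "ball z0 R" and f' = "deriv f"])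
      fix x assume x: "x \<in> ball z0 R"
      then have gx: "good x" and xD: "x \<in> ball z0 \<delta>" using good R by auto
      then show "(f has_field_derivative deriv f x) (at x within ball z0 R)"
        using nicely_meromorphic_on_imp_analytic_at[OF f xD] unfolding good_def
        by (meson DERIV_deriv_iff_field_differentiable analytic_on_imp_differentiable_at
            has_field_derivative_at_within insertI1)
      have "norm (deriv f x) \<le> M * (1 + (norm (f x))\<^sup>2)"
        using M[OF xD] gx by (simp add: good_def spherical_deriv_regular divide_le_eq add_pos_nonneg)
      also have "\<dots> \<le> M * 5"
      proof (rule mult_left_mono)
        have "(norm (f x))\<^sup>2 \<le> 2\<^sup>2" using gx by (intro power_mono) (auto simp: good_def)
        then show "1 + (norm (f x))\<^sup>2 \<le> 5" by simp
        have "0 \<le> spherical_deriv f x"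
          using gx by (simp add: good_def spherical_deriv_regular)
        with M[OF xD] show "0 \<le> M" by simp
      qed
      finally show "norm (deriv f x) \<le> 5 * M" by simp
    qed (use w \<open>R > 0\<close> in auto)
    moreover have "5 * M * norm (w - z0) \<le> 1/2" if "w \<in> ball z0 R" for w
    proof -
      have "M \<ge> 0"
        using M[of z0] z0 \<open>\<delta> > 0\<close> by (simp add: spherical_deriv_regular) (smt (verit) divide_nonneg_nonneg norm_ge_zero zero_le_power2)
      then have "5 * M * norm (w - z0) \<le> 5 * M * \<delta>"
        using that R by (intro mult_left_mono) (auto simp: dist_norm norm_minus_commute)
      with \<delta> show ?thesis by simp
    qed
    ultimately have bd: "norm (f w) \<le> 3/2" if "w \<in> ball z0 R" for w
      using that z0(2) norm_triangle_sub[of "f w" "f z0"] by fastforce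
    have nontriv: "at y within ball z0 R \<noteq> bot"
      using \<open>R > 0\<close> by (auto simp: trivial_limit_within islimpt_ball R_def)
    have evb: "\<forall>\<^sub>F w in at y within ball z0 R. norm (f w) \<le> 3/2"
      using bd by (auto simp: eventually_at_filter)
    have np: "\<not> is_pole f y"
    proof
      assume "is_pole f y"
      then have "filterlim f at_infinity (at y within ball z0 R)"
        unfolding is_pole_def by (rule filterlim_mono) (auto simp: at_le)
      then have "\<forall>\<^sub>F w in at y within ball z0 R. norm (f w) \<ge> 2"
        using filterlim_at_infinity[of 0 f] by force
      with evb have "\<forall>\<^sub>F w in at y within ball z0 R. False"
        by eventually_elim auto
      then show False using nontriv by simp
    qed
    then have "f analytic_on {y}"
      using nicely_meromorphic_on_imp_analytic_at[OF f yD(1)] by simp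
    then have "isCont f y" by (rule analytic_at_imp_isCont)
    then have "((\<lambda>w. norm (f w)) \<longlongrightarrow> norm (f y)) (at y within ball z0 R)"
      by (intro tendsto_norm) (simp add: continuous_at_imp_continuous_at_within continuous_within[symmetric])
    then have "norm (f y) \<le> 3/2"
      using evb nontriv by (rule tendsto_upperbound)
    with np yD(2) show False by (simp add: good_def)
  qed
  then show "norm (f w) \<le> 2" if "w \<in> ball z0 \<delta>" for w
    using that by (force simp: good_def)
  show "f holomorphic_on ball z0 \<delta>"
    using all_good nicely_meromorphic_without_singularities[OF f]
    by (auto simp: good_def analytic_imp_holomorphic)
qed

section \<open>The chordal metric\<close>

fun sphere_inv :: "complex option \<Rightarrow> complex option" where
  "sphere_inv None = Some 0"
| "sphere_inv (Some z) = (if z = 0 then None else Some (inverse z))"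

text \<open>
  Inverse stereographic projection to the sphere of diameter \<open>1\<close> resting on the plane at the
  origin; the north pole represents \<open>\<infinity>\<close>.
\<close>

fun stereo :: "complex option \<Rightarrow> complex \<times> real" where
  "stereo None = (0, 1)"
| "stereo (Some z) = (z / of_real (1 + (norm z)\<^sup>2), (norm z)\<^sup>2 / (1 + (norm z)\<^sup>2))"

text \<open>
  The chordal distance is the length of the chord between the two projected points. From this
  it inherits the triangle inequality, which its defining formula does not make visible.
\<close>

lemma chordal_dist_eq_dist_stereo: "chordal_dist p q = dist (stereo p) (stereo q)"
proof -
  have fin: "chordal_dist (Some z) (Some w) = dist (stereo (Some z)) (stereo (Some w))" for z w
  proof -
    obtain x y u v where zw: "z = Complex x y" "w = Complex u v"
      by (metis complex.collapse)
    define A B where "A = 1 + x\<^sup>2 + y\<^sup>2" and "B = 1 + u\<^sup>2 + v\<^sup>2"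
    have pos: "A > 0" "B > 0" unfolding A_def B_def by (auto simp: add_pos_nonneg)
    have nz: "1 + (norm z)\<^sup>2 = A" "1 + (norm w)\<^sup>2 = B" "(norm z)\<^sup>2 = A - 1" "(norm w)\<^sup>2 = B - 1"
      by (simp_all add: zw A_def B_def cmod_power2)
    have id: "(x * B - u * A)\<^sup>2 + (y * B - v * A)\<^sup>2 + ((A - 1) * B - (B - 1) * A)\<^sup>2
        = ((x - u)\<^sup>2 + (y - v)\<^sup>2) * (A * B)"
      unfolding A_def B_def by algebra
    have "(dist (stereo (Some z)) (stereo (Some w)))\<^sup>2
        = (x / A - u / B)\<^sup>2 + (y / A - v / B)\<^sup>2 + ((A - 1) / A - (B - 1) / B)\<^sup>2"
      by (simp add: dist_Pair_Pair nz, simp add: dist_norm cmod_power2 zw)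
    also have "\<dots> = ((x * B - u * A)\<^sup>2 + (y * B - v * A)\<^sup>2 + ((A - 1) * B - (B - 1) * A)\<^sup>2) / (A * B)\<^sup>2"
      using pos by (simp add: diff_frac_eq power_divide add_divide_distrib)
    also have "\<dots> = ((x - u)\<^sup>2 + (y - v)\<^sup>2) / (A * B)"
      unfolding id using pos by (simp add: power2_eq_square)
    also have "\<dots> = (chordal_dist (Some z) (Some w))\<^sup>2"
      using pos by (simp add: nz power_divide power_mult_distrib, simp add: zw cmod_power2)
    finally show ?thesis
      using chordal_dist_bounds(1) by (metis power2_eq_iff_nonneg zero_le_dist)
  qed
  have inf: "chordal_dist (Some z) None = dist (stereo (Some z)) (stereo None)" for z
  proof -
    define A where "A = 1 + (norm z)\<^sup>2"
    have pos: "A > 0" unfolding A_def by (auto simp: add_pos_nonneg)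
    have "(dist (stereo (Some z)) (stereo None))\<^sup>2 = (norm z / A)\<^sup>2 + ((A - 1) / A - 1)\<^sup>2"
      using pos by (simp add: dist_Pair_Pair A_def[symmetric] norm_divide)
        (simp add: A_def dist_norm power2_commute)
    also have "\<dots> = ((norm z)\<^sup>2 + 1) / A\<^sup>2"
      using pos by (simp add: field_simps power2_eq_square)
    also have "\<dots> = A / A\<^sup>2" by (simp add: A_def add.commute)
    also have "\<dots> = 1 / A" using pos by (simp add: power2_eq_square)
    also have "\<dots> = (chordal_dist (Some z) None)\<^sup>2"
      using pos by (simp add: A_def[symmetric] power_divide)
    finally show ?thesis
      using chordal_dist_bounds(1) by (metis power2_eq_iff_nonneg zero_le_dist)
  qed
  show ?thesis
  proof (cases p; cases q)
    fix w assume "p = None" "q = Some w"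
    then show ?thesis using inf[of w] by (metis chordal_dist.simps(2,3) dist_commute)
  qed (use fin inf in simp_all)
qed

lemma chordal_dist_triangle: "chordal_dist p q \<le> chordal_dist r p + chordal_dist r q"
  unfolding chordal_dist_eq_dist_stereo by (rule dist_triangle3)

lemma chordal_dist_eq_0_iff: "chordal_dist p q = 0 \<longleftrightarrow> p = q"
proof -
  have *: "sqrt (1 + (norm z)\<^sup>2) \<noteq> 0" for z :: complex
    by (simp add: add_nonneg_eq_0_iff)
  show ?thesis by (cases p; cases q) (use * in auto)
qed

lemma chordal_dist_sphere_inv: "chordal_dist (sphere_inv p) (sphere_inv q) = chordal_dist p q"
proof -
  have s: "sqrt (1 + (inverse (norm z))\<^sup>2) = sqrt (1 + (norm z)\<^sup>2) / norm z" if "z \<noteq> 0" for z :: complex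
  proof -
    have "1 + (inverse (norm z))\<^sup>2 = (1 + (norm z)\<^sup>2) / (norm z)\<^sup>2"
      using that by (simp add: field_simps)
    then show ?thesis by (simp add: real_sqrt_divide)
  qed
  have d: "norm (inverse z - inverse w) = norm (z - w) / (norm z * norm w)"
    if "z \<noteq> 0" "w \<noteq> 0" for z w :: complex
    unfolding inverse_diff_inverse[OF that] norm_minus_cancel norm_mult norm_inverse
    by (simp add: divide_inverse)
  show ?thesis
    by (cases p; cases q) (auto simp: s d norm_inverse norm_minus_commute)
qed

lemma chordal_dist_le_norm: "chordal_dist (Some z) (Some w) \<le> norm (z - w)"
proof -
  have "1 * 1 \<le> sqrt (1 + (norm z)\<^sup>2) * sqrt (1 + (norm w)\<^sup>2)"
    by (rule mult_mono) auto
  then show ?thesis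
    using frac_le[of "norm (z - w)" "norm (z - w)" 1] by simp
qed

text \<open>
  Holomorphy in a single chart of the sphere: the whole set has to be mapped either into the
  complement of \<open>\<infinity>\<close> or into the complement of \<open>0\<close>. The constant \<open>\<infinity>\<close> is included.
\<close>

definition sphere_holomorphic_on :: "(complex \<Rightarrow> complex option) \<Rightarrow> complex set \<Rightarrow> bool" where
  "sphere_holomorphic_on G B \<longleftrightarrow> (\<exists>g. g holomorphic_on B \<and>
     ((\<forall>w\<in>B. G w = Some (g w)) \<or> (\<forall>w\<in>B. G w = sphere_inv (Some (g w)))))"

text \<open>
  Stated with the chordal distance, which is bi-Lipschitz equivalent to the geodesic one and
  satisfies convenient algebraic estimates.
\<close>

definition chordal_uniform_limit ::
    "complex set \<Rightarrow> (nat \<Rightarrow> complex \<Rightarrow> complex option) \<Rightarrow> (complex \<Rightarrow> complex option) \<Rightarrow> bool" where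
  "chordal_uniform_limit B S G \<longleftrightarrow>
     (\<forall>e>0. \<forall>\<^sub>F n in sequentially. \<forall>w\<in>B. chordal_dist (S n w) (G w) < e)"

section \<open>Marty's normality criterion\<close>

text \<open>
  The estimate for bounded spherical derivative applies to \<open>f\<close> or to \<open>1 / f\<close>, according to
  whether \<open>f z0\<close> lies in the lower or in the upper hemisphere.
\<close>

lemma bounded_spherical_deriv_imp_bounded_chart:
  assumes f: "f nicely_meromorphic_on ball z0 \<delta>" and "\<delta> > 0"
    and M: "\<And>w. w \<in> ball z0 \<delta> \<Longrightarrow> spherical_deriv f w \<le> M" and \<delta>: "10 * M * \<delta> \<le> 1"
  obtains g where "g holomorphic_on ball z0 \<delta>" "\<And>w. w \<in> ball z0 \<delta> \<Longrightarrow> norm (g w) \<le> 2"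
    "(\<forall>w\<in>ball z0 \<delta>. sphere_val f w = Some (g w)) \<or>
     (\<forall>w\<in>ball z0 \<delta>. sphere_val f w = sphere_inv (Some (g w)))"
proof (cases "\<not> is_pole f z0 \<and> norm (f z0) \<le> 1")
  case True
  note b = bounded_spherical_deriv_imp_bounded[OF f \<open>\<delta> > 0\<close> M \<delta>]
  show ?thesis
  proof (rule that)
    show h: "f holomorphic_on ball z0 \<delta>" using b True by blast
    show "norm (f w) \<le> 2" if "w \<in> ball z0 \<delta>" for w using b True that by blast
    show "(\<forall>w\<in>ball z0 \<delta>. sphere_val f w = Some (f w)) \<or>
     (\<forall>w\<in>ball z0 \<delta>. sphere_val f w = sphere_inv (Some (f w)))"
      using not_is_pole_holomorphic[OF open_ball _ h] by (simp add: sphere_val_def)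
  qed
next
  case False
  define g where "g = (\<lambda>w. inverse (f w))"
  have z0: "z0 \<in> ball z0 \<delta>" using \<open>\<delta> > 0\<close> by simp
  have ng: "g nicely_meromorphic_on ball z0 \<delta>"
    unfolding g_def by (rule nicely_meromorphic_on_inverse[OF f])
  have fz0: "is_pole f z0 \<Longrightarrow> f z0 = 0" using is_pole_zero_at_nicely_mero[OF f _ z0] .
  have nopole: "\<not> is_pole g z0"
  proof
    assume "is_pole g z0"
    then have iz: "isolated_zero f z0" by (simp add: g_def is_pole_inverse_iff)
    then have "f z0 = 0"
      using f z0 by (intro zero_isolated_zero_nicely_meromorphic) (auto intro: nicely_meromorphic_on_subset)
    moreover have "\<not> is_pole f z0" using iz pole_is_not_zero by blast
    ultimately show False using False by simp
  qed
  have small: "norm (g z0) \<le> 1"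
    using False fz0 by (auto simp: g_def norm_inverse inverse_le_1_iff)
  have Mg: "spherical_deriv g w \<le> M" if "w \<in> ball z0 \<delta>" for w
    using M[OF that] spherical_deriv_inverse[OF f open_ball that] by (simp add: g_def)
  note b = bounded_spherical_deriv_imp_bounded[OF ng \<open>\<delta> > 0\<close> Mg \<delta> nopole small]
  have nz: "\<forall>z\<in>ball z0 \<delta>. f z = 0 \<longrightarrow> is_pole f z \<or> isolated_zero f z"
    using identically_zero_or_isolated_zeros[OF f open_ball connected_ball] False z0 by force
  have "sphere_val f w = sphere_inv (Some (g w))" if w: "w \<in> ball z0 \<delta>" for w
  proof -
    have "\<not> is_pole g w" using not_is_pole_holomorphic[OF open_ball w b(1)] .
    then have "\<not> isolated_zero f w" by (simp add: g_def is_pole_inverse_iff)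
    with nz w have "f w = 0 \<longrightarrow> is_pole f w" by blast
    moreover have "is_pole f w \<longrightarrow> f w = 0" using is_pole_zero_at_nicely_mero[OF f _ w] by blast
    ultimately show ?thesis by (auto simp: sphere_val_def g_def)
  qed
  with b that show ?thesis by blast
qed

lemma chordal_uniform_limit_chart:
  assumes "uniform_limit B g h sequentially"
    and "(\<forall>n. \<forall>w\<in>B. S n w = Some (g n w)) \<and> G = (\<lambda>w. Some (h w)) \<or>
         (\<forall>n. \<forall>w\<in>B. S n w = sphere_inv (Some (g n w))) \<and> G = (\<lambda>w. sphere_inv (Some (h w)))"
  shows "chordal_uniform_limit B S G"
  unfolding chordal_uniform_limit_def
proof safe
  fix e :: real assume "e > 0"
  with assms(1) have "\<forall>\<^sub>F n in sequentially. \<forall>w\<in>B. dist (g n w) (h w) < e"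
    by (rule uniform_limitD)
  then show "\<forall>\<^sub>F n in sequentially. \<forall>w\<in>B. chordal_dist (S n w) (G w) < e"
  proof eventually_elim
    case (elim n)
    have "chordal_dist (S n w) (G w) \<le> dist (g n w) (h w)" if "w \<in> B" for w
      using assms(2) that chordal_dist_le_norm[of "g n w" "h w"]
      by (auto simp: chordal_dist_sphere_inv dist_norm simp del: sphere_inv.simps chordal_dist.simps)
    with elim show ?case by fastforce
  qed
qed

text \<open>
  Infinitely many members of the sequence are bounded in the same chart; there Montel's theorem
  for bounded holomorphic functions gives uniform convergence, which becomes chordal convergence
  because the chordal distance is dominated by the Euclidean one in either chart.
\<close>

lemma chordal_montel_on_ball:
  assumes f: "\<And>n. s n nicely_meromorphic_on ball z0 \<delta>" and "\<delta> > 0"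
    and M: "\<And>n w. w \<in> ball z0 \<delta> \<Longrightarrow> spherical_deriv (s n) w \<le> M" and \<delta>: "10 * M * \<delta> \<le> 1"
  obtains k :: "nat \<Rightarrow> nat" and G where "strict_mono k" "sphere_holomorphic_on G (ball z0 (\<delta>/2))"
    "chordal_uniform_limit (ball z0 (\<delta>/2)) (\<lambda>n. sphere_val (s (k n))) G"
proof -
  have "\<exists>g. g holomorphic_on ball z0 \<delta> \<and> (\<forall>w \<in> ball z0 \<delta>. norm (g w) \<le> 2) \<and>
    ((\<forall>w\<in>ball z0 \<delta>. sphere_val (s n) w = Some (g w)) \<or>
     (\<forall>w\<in>ball z0 \<delta>. sphere_val (s n) w = sphere_inv (Some (g w))))" for n
    using bounded_spherical_deriv_imp_bounded_chart[OF f \<open>\<delta> > 0\<close> M \<delta>] by metis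
  then obtain g where g: "\<And>n. g n holomorphic_on ball z0 \<delta>"
    "\<And>n w. w \<in> ball z0 \<delta> \<Longrightarrow> norm (g n w) \<le> 2" and
    alt: "\<And>n. (\<forall>w\<in>ball z0 \<delta>. sphere_val (s n) w = Some (g n w)) \<or>
     (\<forall>w\<in>ball z0 \<delta>. sphere_val (s n) w = sphere_inv (Some (g n w)))"
    by metis
  define A where "A = {n. \<forall>w\<in>ball z0 \<delta>. sphere_val (s n) w = Some (g n w)}"
  define A' where "A' = (if infinite A then A else - A)"
  have "infinite A'" unfolding A'_def by (metis Compl_eq_Diff_UNIV Diff_infinite_finite infinite_UNIV_nat)
  define k0 where "k0 = enumerate A'"
  have k0: "strict_mono k0" "\<And>n. k0 n \<in> A'"
    using \<open>infinite A'\<close> by (simp_all add: k0_def strict_mono_enumerate enumerate_in_set)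
  obtain h r where h: "h holomorphic_on ball z0 \<delta>" and r: "strict_mono (r :: nat \<Rightarrow> nat)"
    and lim: "\<And>K. compact K \<Longrightarrow> K \<subseteq> ball z0 \<delta> \<Longrightarrow> uniform_limit K ((\<lambda>n. g (k0 n)) \<circ> r) h sequentially"
  proof (rule Montel[where S = "ball z0 \<delta>" and \<H> = "range g" and \<F> = "\<lambda>n. g (k0 n)"])
    show "\<exists>B. \<forall>h\<in>range g. \<forall>z\<in>K. norm (h z) \<le> B" if "K \<subseteq> ball z0 \<delta>" for K
      using g(2) that by blast
  qed (use g in auto)
  have sub: "cball z0 (\<delta>/2) \<subseteq> ball z0 \<delta>" "ball z0 (\<delta>/2) \<subseteq> cball z0 (\<delta>/2)" using \<open>\<delta> > 0\<close> by auto
  have ul: "uniform_limit (ball z0 (\<delta>/2)) (\<lambda>n. g (k0 (r n))) h sequentially"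
    using uniform_limit_on_subset[OF lim[OF compact_cball sub(1)] sub(2)] by (simp add: o_def)
  have hh: "h holomorphic_on ball z0 (\<delta>/2)" using h sub by (meson holomorphic_on_subset order_trans)
  show ?thesis
  proof (cases "infinite A")
    case True
    then have "k0 n \<in> A" for n using k0(2) by (simp add: A'_def)
    then have "\<forall>n. \<forall>w\<in>ball z0 (\<delta>/2). sphere_val (s (k0 (r n))) w = Some (g (k0 (r n)) w)"
      using subset_trans[OF sub(2,1)] unfolding A_def by blast
    then have "chordal_uniform_limit (ball z0 (\<delta>/2)) (\<lambda>n. sphere_val (s ((k0 \<circ> r) n))) (\<lambda>w. Some (h w))"
      using chordal_uniform_limit_chart[OF ul] by simp
    then show ?thesis
      using hh by (intro that[of "k0 \<circ> r"]) (auto simp: sphere_holomorphic_on_def strict_mono_o k0 r)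
  next
    case False
    then have "k0 n \<notin> A" for n using k0(2) by (auto simp: A'_def)
    then have "\<forall>n. \<forall>w\<in>ball z0 (\<delta>/2). sphere_val (s (k0 (r n))) w = sphere_inv (Some (g (k0 (r n)) w))"
      using alt subset_trans[OF sub(2,1)] unfolding A_def by blast
    then have "chordal_uniform_limit (ball z0 (\<delta>/2)) (\<lambda>n. sphere_val (s ((k0 \<circ> r) n))) (\<lambda>w. sphere_inv (Some (h w)))"
      using chordal_uniform_limit_chart[OF ul] by simp
    then show ?thesis
      using hh by (intro that[of "k0 \<circ> r"]) (auto simp: sphere_holomorphic_on_def strict_mono_o k0 r simp del: sphere_inv.simps)
  qed
qed

lemma sphere_holomorphic_on_subset:
  "sphere_holomorphic_on G B \<Longrightarrow> C \<subseteq> B \<Longrightarrow> sphere_holomorphic_on G C"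
  unfolding sphere_holomorphic_on_def by (meson holomorphic_on_subset subsetD)

text \<open>
  By the identity theorem, if the value \<open>\<infinity>\<close> is taken on some nonempty open set inside a chart disk, it
  is taken on the whole disk. So the interior of the set of infinities is open and closed in the
  domain. If it is empty, all infinities are isolated zeros of a chart function, that is, poles.
\<close>

lemma locally_sphere_holomorphic_imp_meromorphic_or_infinite:
  assumes D: "open D" "connected D"
    and G: "\<And>z. z \<in> D \<Longrightarrow> \<exists>r>0. ball z r \<subseteq> D \<and> sphere_holomorphic_on G (ball z r)"
  shows "(\<exists>\<phi>. \<phi> nicely_meromorphic_on D \<and> (\<forall>z\<in>D. G z = sphere_val \<phi> z)) \<or> (\<forall>z\<in>D. G z = None)"
proof -
  define N where "N = interior {z \<in> D. G z = None}"
  have "\<exists>r>0. ball z r \<subseteq> D - N" if z: "z \<in> D - N" for z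
  proof -
    obtain r g where r: "r > 0" "ball z r \<subseteq> D" and g: "g holomorphic_on ball z r"
      and alt: "(\<forall>w\<in>ball z r. G w = Some (g w)) \<or> (\<forall>w\<in>ball z r. G w = sphere_inv (Some (g w)))"
      using G[of z] z unfolding sphere_holomorphic_on_def by blast
    have "w \<notin> N" if w: "w \<in> ball z r" for w
    proof
      assume "w \<in> N"
      then obtain T where T: "open T" "w \<in> T" "T \<subseteq> {z \<in> D. G z = None}"
        unfolding N_def interior_def by blast
      have "G w = None" using T by blast
      then have inv: "\<forall>w\<in>ball z r. G w = sphere_inv (Some (g w))" using alt w by auto
      have g0: "g v = 0" if "v \<in> T \<inter> ball z r" for v
      proof -
        have "G v = None" "v \<in> ball z r" using that T by blast+
        then show ?thesis using inv by (auto split: if_splits)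
      qed
      have zero: "g v = 0" if "v \<in> ball z r" for v
      proof (rule analytic_continuation[OF g open_ball connected_ball _ w _ _ that])
        show "T \<inter> ball z r \<subseteq> ball z r" by blast
        show "w islimpt T \<inter> ball z r"
          using T w by (intro interior_limit_point) (auto simp: interior_open)
      qed (use g0 in blast)
      have "ball z r \<subseteq> {z \<in> D. G z = None}" using zero inv r by auto
      then have "z \<in> N" using r unfolding N_def
        by (meson centre_in_ball interiorI open_ball)
      with z show False by blast
    qed
    with r show ?thesis by blast
  qed
  then have "open (D - N)" by (simp add: open_contains_ball)
  moreover have "open N" "N \<subseteq> D" using interior_subset unfolding N_def by auto
  ultimately consider "N = {}" | "N = D"
    using D(2) connectedD[of D N "D - N"] by blast
  then show ?thesis
  proof cases
    case 2
    then show ?thesis unfolding N_def using interior_subset by blast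
  next
    case 1
    \<comment> \<open>the value 0 at infinity is the one required of a nicely meromorphic function\<close>
    define \<phi> where "\<phi> z = (case G z of None \<Rightarrow> 0 | Some w \<Rightarrow> w)" for z
    have "\<phi> meromorphic_on {z} \<and> (is_pole \<phi> z \<and> \<phi> z = 0 \<or> \<phi> \<midarrow>z\<rightarrow> \<phi> z) \<and> G z = sphere_val \<phi> z"
      if z: "z \<in> D" for z
    proof -
      obtain r g where r: "r > 0" "ball z r \<subseteq> D" and g: "g holomorphic_on ball z r"
        and alt: "(\<forall>w\<in>ball z r. G w = Some (g w)) \<or> (\<forall>w\<in>ball z r. G w = sphere_inv (Some (g w)))"
        using G[of z] z unfolding sphere_holomorphic_on_def by blast
      have zr: "z \<in> ball z r" using r by simp
      have ng: "g nicely_meromorphic_on ball z r"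
        using g by (simp add: analytic_on_imp_nicely_meromorphic_on analytic_on_open)
      have anag: "g analytic_on {z}"
        using g r by (meson centre_in_ball holomorphic_on_imp_analytic_at open_ball)
      obtain \<psi> where \<psi>: "\<psi> nicely_meromorphic_on ball z r" "\<And>w. w \<in> ball z r \<Longrightarrow> \<phi> w = \<psi> w"
        and Gz: "G z = sphere_val \<psi> z"
      proof (cases "\<forall>w\<in>ball z r. G w = Some (g w)")
        case True
        then show ?thesis
          using ng zr analytic_at_imp_no_pole[OF anag] by (intro that[of g]) (auto simp: \<phi>_def sphere_val_def)
      next
        case False
        with alt have inv: "\<forall>w\<in>ball z r. G w = sphere_inv (Some (g w))" by blast
        show ?thesis
        proof (rule that[of "\<lambda>w. inverse (g w)"])
          show "(\<lambda>w. inverse (g w)) nicely_meromorphic_on ball z r"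
            by (rule nicely_meromorphic_on_inverse[OF ng])
          show "\<phi> w = inverse (g w)" if "w \<in> ball z r" for w
            using inv that by (simp add: \<phi>_def)
          have "\<not> (\<forall>w\<in>ball z r. g w = 0)"
          proof
            assume "\<forall>w\<in>ball z r. g w = 0"
            then have "ball z r \<subseteq> {z \<in> D. G z = None}" using inv r by auto
            then have "z \<in> N" using r unfolding N_def
              by (meson centre_in_ball interiorI open_ball)
            with 1 show False by blast
          qed
          then have "g z = 0 \<longrightarrow> isolated_zero g z"
            using identically_zero_or_isolated_zeros[OF ng open_ball connected_ball] zr
              analytic_at_imp_no_pole[OF anag] by blast
          moreover have "isolated_zero g z \<longrightarrow> g z = 0"
            using zero_isolated_zero_analytic[OF _ anag] by blast
          ultimately show "G z = sphere_val (\<lambda>w. inverse (g w)) z"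
            using inv zr by (simp add: sphere_val_def is_pole_inverse_iff)
        qed
      qed
      have ev: "\<forall>\<^sub>F w in at z. \<phi> w = \<psi> w"
        using eventually_at_in_open'[OF open_ball zr] by eventually_elim (rule \<psi>(2))
      have "\<psi> meromorphic_on {z}" using \<psi>(1) zr
        by (auto simp: nicely_meromorphic_on_def intro: meromorphic_on_subset)
      then have "\<phi> meromorphic_on {z}"
        using meromorphic_on_cong[of "{z}" \<phi> \<psi> "{z}"] ev by simp
      moreover have pc: "is_pole \<phi> z \<longleftrightarrow> is_pole \<psi> z" by (rule is_pole_cong[OF ev refl])
      moreover have "(\<phi> \<midarrow>z\<rightarrow> \<phi> z) \<longleftrightarrow> (\<psi> \<midarrow>z\<rightarrow> \<psi> z)"
        using tendsto_cong[OF ev] \<psi>(2)[OF zr] by simp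
      moreover have "is_pole \<psi> z \<and> \<psi> z = 0 \<or> \<psi> \<midarrow>z\<rightarrow> \<psi> z"
        using \<psi>(1) zr by (auto simp: nicely_meromorphic_on_def)
      ultimately show ?thesis
        using \<psi>(2)[OF zr] Gz by (simp add: sphere_val_def)
    qed
    then have "\<phi> nicely_meromorphic_on D" "\<forall>z\<in>D. G z = sphere_val \<phi> z"
      unfolding nicely_meromorphic_on_def using meromorphic_on_meromorphic_at by blast+
    then show ?thesis by blast
  qed
qed

lemma chordal_uniform_limitD:
  assumes "chordal_uniform_limit B S G" "e > 0" "w \<in> B"
  shows "\<forall>\<^sub>F n in sequentially. chordal_dist (S n w) (G w) < e"
  using assms unfolding chordal_uniform_limit_def by (auto elim!: eventually_mono allE[of _ e])

lemma chordal_uniform_limit_unique: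
  assumes "chordal_uniform_limit B S G" "chordal_uniform_limit C S H" "w \<in> B" "w \<in> C"
  shows "G w = H w"
proof -
  have "chordal_dist (G w) (H w) \<le> 0 + e" if "e > 0" for e
  proof -
    have "\<forall>\<^sub>F n in sequentially. chordal_dist (S n w) (G w) < e/2"
      "\<forall>\<^sub>F n in sequentially. chordal_dist (S n w) (H w) < e/2"
      using assms chordal_uniform_limitD[OF _ half_gt_zero[OF that]] by blast+
    then have "\<forall>\<^sub>F n in sequentially. chordal_dist (G w) (H w) \<le> 0 + e"
    proof eventually_elim
      case (elim n)
      then show ?case using chordal_dist_triangle[of "G w" "H w" "S n w"] by simp
    qed
    then show ?thesis by simp
  qed
  then have "chordal_dist (G w) (H w) \<le> 0" by (rule field_le_epsilon)
  then show ?thesis using chordal_dist_bounds(1) chordal_dist_eq_0_iff by (metis order_antisym)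
qed

lemma chordal_uniform_limit_imp_spherical:
  assumes "chordal_uniform_limit B S G" "e > 0"
  shows "\<forall>\<^sub>F n in sequentially. \<forall>w\<in>B. spherical_dist (S n w) (G w) < e"
proof -
  \<comment> \<open>the cap keeps d in the range where arcsin inverts sin\<close>
  define d where "d = min e 1"
  have d: "0 < d" "d \<le> 1" "d \<le> e" using assms by (auto simp: d_def)
  have pi: "(1::real) < pi / 2" using pi_gt3 by simp
  have "0 < sin d" using d pi by (intro sin_gt_zero) auto
  with assms(1) have "\<forall>\<^sub>F n in sequentially. \<forall>w\<in>B. chordal_dist (S n w) (G w) < sin d"
    by (simp add: chordal_uniform_limit_def)
  then show ?thesis
  proof eventually_elim
    case (elim n)
    have "spherical_dist (S n w) (G w) < e" if "w \<in> B" for w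
    proof -
      have "arcsin (chordal_dist (S n w) (G w)) < arcsin (sin d)"
        using elim that chordal_dist_bounds[of "S n w" "G w"]
        by (intro arcsin_less_arcsin) auto
      also have "\<dots> = d" using d pi by (intro arcsin_sin) auto
      finally show ?thesis using d by (simp add: spherical_dist_def)
    qed
    then show ?case by blast
  qed
qed

lemma countable_ball_cover:
  fixes D :: "'a::{second_countable_topology, metric_space} set"
  assumes "D \<noteq> {}" and "\<And>z. z \<in> D \<Longrightarrow> 0 < r z"
  shows "\<exists>c :: nat \<Rightarrow> 'a. range c \<subseteq> D \<and> D \<subseteq> (\<Union>i. ball (c i) (r (c i)))"
proof -
  define \<F> where "\<F> = (\<lambda>z. ball z (r z)) ` D"
  obtain \<F>' where F: "\<F>' \<subseteq> \<F>" "countable \<F>'" "\<Union>\<F>' = \<Union>\<F>"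
    using Lindelof[of \<F>] by (auto simp: \<F>_def)
  have D: "D \<subseteq> \<Union>\<F>" using assms by (force simp: \<F>_def)
  have "\<F>' \<noteq> {}"
  proof
    assume "\<F>' = {}"
    then have "\<Union>\<F> = {}" using F(3) by simp
    with D assms(1) show False by blast
  qed
  have "\<exists>z\<in>D. from_nat_into \<F>' i = ball z (r z)" for i
    using from_nat_into[OF \<open>\<F>' \<noteq> {}\<close>, of i] F(1) by (auto simp: \<F>_def)
  then obtain c where c: "\<And>i. c i \<in> D" "\<And>i. from_nat_into \<F>' i = ball (c i) (r (c i))" by metis
  have "from_nat_into \<F>' = (\<lambda>i. ball (c i) (r (c i)))" using c(2) by (rule ext)
  then have "\<F>' = range (\<lambda>i. ball (c i) (r (c i)))"
    using range_from_nat_into[OF \<open>\<F>' \<noteq> {}\<close> F(2)] by simp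
  then have "\<Union>\<F>' = (\<Union>i. ball (c i) (r (c i)))" by (rule arg_cong)
  then have "D \<subseteq> (\<Union>i. ball (c i) (r (c i)))" using D F(3) by simp
  moreover have "range c \<subseteq> D" using c(1) by blast
  ultimately show ?thesis by blast
qed

text \<open>
  Every point has a disk on which subsequences converge. Countably many of these disks cover
  the domain, a diagonal sequence converges on all of them, and by uniqueness of limits the local
  limits fit together to a sphere-valued function that is holomorphic in local charts.
\<close>

theorem Marty_normality_criterion:
  assumes D: "open D" "connected D"
    and F: "\<And>f. f \<in> F \<Longrightarrow> f nicely_meromorphic_on D"
    and bd: "\<And>z. z \<in> D \<Longrightarrow> \<exists>r>0. \<exists>M. \<forall>f\<in>F. \<forall>w \<in> D \<inter> ball z r. spherical_deriv f w \<le> M"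
  shows "normal_family_on F D"
proof (cases "D = {}")
  case True
  then show ?thesis
    unfolding normal_family_on_def locally_uniform_spherical_limit_def
    by (auto intro!: exI[of _ id] strict_mono_id)
next
  case False
  have "\<exists>\<delta>>0. ball z \<delta> \<subseteq> D \<and> (\<exists>M. 10 * M * \<delta> \<le> 1 \<and> (\<forall>f\<in>F. \<forall>w\<in>ball z \<delta>. spherical_deriv f w \<le> M))"
    if z: "z \<in> D" for z
  proof -
    obtain r M where r: "r > 0" "\<forall>f\<in>F. \<forall>w \<in> D \<inter> ball z r. spherical_deriv f w \<le> M"
      using bd[OF z] by blast
    obtain r' where r': "r' > 0" "ball z r' \<subseteq> D" using D z by (auto simp: open_contains_ball)
    \<comment> \<open>small enough for functions with spherical derivative at most M to stay in one chart\<close>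
    define \<delta> where "\<delta> = min (min r r') (1 / (10 * (\<bar>M\<bar> + 1)))"
    have "\<delta> > 0" using r r' by (simp add: \<delta>_def)
    moreover have "ball z \<delta> \<subseteq> D" "ball z \<delta> \<subseteq> ball z r" using r' by (auto simp: \<delta>_def)
    moreover have "10 * M * \<delta> \<le> 10 * (\<bar>M\<bar> + 1) * \<delta>" using \<open>\<delta> > 0\<close> by (intro mult_right_mono) auto
    then have "10 * M * \<delta> \<le> 1" if "10 * (\<bar>M\<bar> + 1) * \<delta> \<le> 1" using that by linarith
    moreover have "10 * (\<bar>M\<bar> + 1) * \<delta> \<le> 1"
    proof -
      have "\<delta> \<le> 1 / (10 * (\<bar>M\<bar> + 1))" by (simp add: \<delta>_def)
      then show ?thesis by (simp add: pos_le_divide_eq mult.commute add_nonneg_pos)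
    qed
    ultimately show ?thesis using r by (intro exI[of _ \<delta>] conjI exI[of _ M]) blast+
  qed
  then obtain \<delta> where \<delta>: "\<And>z. z \<in> D \<Longrightarrow> \<delta> z > 0" "\<And>z. z \<in> D \<Longrightarrow> ball z (\<delta> z) \<subseteq> D"
    "\<And>z. z \<in> D \<Longrightarrow> \<exists>M. 10 * M * \<delta> z \<le> 1 \<and> (\<forall>f\<in>F. \<forall>w\<in>ball z (\<delta> z). spherical_deriv f w \<le> M)"
    by metis
  have half: "\<delta> z / 2 > 0" if "z \<in> D" for z using \<delta>(1)[OF that] by simp
  obtain c :: "nat \<Rightarrow> complex" where c: "range c \<subseteq> D \<and> D \<subseteq> (\<Union>i. ball (c i) (\<delta> (c i) / 2))"
    using countable_ball_cover[of D "\<lambda>z. \<delta> z / 2", OF False half] ..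
  have cD: "c i \<in> D" for i :: nat using c by blast
  define B where "B i = ball (c i) (\<delta> (c i) / 2)" for i :: nat
  show ?thesis
    unfolding normal_family_on_def
  proof (intro allI impI)
    fix s :: "nat \<Rightarrow> complex \<Rightarrow> complex" assume s: "\<forall>n. s n \<in> F"
    define P where "P i k \<longleftrightarrow> (\<exists>G. sphere_holomorphic_on G (B i) \<and>
      chordal_uniform_limit (B i) (\<lambda>n. sphere_val (s (k n))) G)" for i and k :: "nat \<Rightarrow> nat"
    obtain k where k: "strict_mono (k :: nat \<Rightarrow> nat)" "\<And>i. P i (id \<circ> k)"
    proof (rule subsequence_diagonalization_lemma[of P id])
      fix i and r :: "nat \<Rightarrow> nat"
      obtain M where M: "10 * M * \<delta> (c i) \<le> 1"
        "\<And>f w. f\<in>F \<Longrightarrow> w\<in>ball (c i) (\<delta> (c i)) \<Longrightarrow> spherical_deriv f w \<le> M"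
        using \<delta>(3)[OF cD] by metis
      have "s (r n) nicely_meromorphic_on ball (c i) (\<delta> (c i))" for n
        using F s \<delta>(2)[OF cD] nicely_meromorphic_on_subset by metis
      then obtain k G where "strict_mono k" "sphere_holomorphic_on G (B i)"
        "chordal_uniform_limit (B i) (\<lambda>n. sphere_val (s (r (k n)))) G"
        unfolding B_def
        using chordal_montel_on_ball[of "\<lambda>n. s (r n)" "c i" "\<delta> (c i)" M] M s \<delta>(1)[OF cD] by metis
      then show "\<exists>k. strict_mono k \<and> P i (r \<circ> k)" by (auto simp: P_def)
    next
      fix i N and r k1 k2 :: "nat \<Rightarrow> nat"
      assume P1: "P i (r \<circ> k1)" and sub: "\<And>j. N \<le> j \<Longrightarrow> \<exists>j'\<ge>j. k2 j = k1 j'"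
      have pass: "\<forall>\<^sub>F n in sequentially. Q (r (k2 n))" if ev: "\<forall>\<^sub>F n in sequentially. Q (r (k1 n))" for Q
      proof -
        obtain N0 where N0: "\<forall>n\<ge>N0. Q (r (k1 n))"
          using ev unfolding eventually_sequentially ..
        have "Q (r (k2 n))" if "n \<ge> max N N0" for n
          using sub[of n] N0 that by (metis max.bounded_iff order_trans)
        then show ?thesis unfolding eventually_sequentially by blast
      qed
      obtain G where G: "sphere_holomorphic_on G (B i)"
        and lim: "chordal_uniform_limit (B i) (\<lambda>n. sphere_val (s (r (k1 n)))) G"
        using P1 by (auto simp: P_def)
      have "chordal_uniform_limit (B i) (\<lambda>n. sphere_val (s (r (k2 n)))) G"
        using lim pass[of "\<lambda>m. \<forall>w\<in>B i. chordal_dist (sphere_val (s m) w) (G w) < e" for e]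
        by (simp add: chordal_uniform_limit_def)
      with G show "P i (r \<circ> k2)" by (auto simp: P_def)
    qed (rule that)
    then have "\<forall>i. \<exists>G. sphere_holomorphic_on G (B i) \<and> chordal_uniform_limit (B i) (\<lambda>n. sphere_val (s (k n))) G"
      by (simp add: P_def)
    then obtain H where H: "\<And>i. sphere_holomorphic_on (H i) (B i)"
      "\<And>i. chordal_uniform_limit (B i) (\<lambda>n. sphere_val (s (k n))) (H i)"
      by metis
    define G where "G w = H (LEAST i. w \<in> B i) w" for w
    have GH: "G w = H i w" if "w \<in> B i" for i w
      unfolding G_def by (rule chordal_uniform_limit_unique[OF H(2) H(2) LeastI that]) (rule that)
    have G1: "sphere_holomorphic_on G (B i)" for i
      using H(1)[of i] GH unfolding sphere_holomorphic_on_def by metis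
    have G2: "chordal_uniform_limit (B i) (\<lambda>n. sphere_val (s (k n))) G" for i
      using H(2)[of i] GH unfolding chordal_uniform_limit_def by simp
    have cover: "\<exists>i. z \<in> B i" if "z \<in> D" for z using c that unfolding B_def by blast
    have "B i \<subseteq> D" for i
      using \<delta>(2)[OF cD[of i]] \<delta>(1)[OF cD[of i]] by (auto simp: B_def)
    have "locally_uniform_spherical_limit D (\<lambda>n. sphere_val (s (k n))) G"
      unfolding locally_uniform_spherical_limit_def
    proof
      fix z assume "z \<in> D"
      then obtain i where "z \<in> B i" using cover by blast
      moreover have "\<forall>\<^sub>F n in sequentially. \<forall>w\<in>B i \<inter> D. spherical_dist (sphere_val (s (k n)) w) (G w) < e"
        if "e > 0" for e
        using chordal_uniform_limit_imp_spherical[OF G2 that] by eventually_elim blast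
      ultimately show "\<exists>U. open U \<and> z \<in> U \<and> (\<forall>e>0. \<forall>\<^sub>F n in sequentially.
          \<forall>w\<in>U \<inter> D. spherical_dist (sphere_val (s (k n)) w) (G w) < e)"
        by (intro exI[of _ "B i"]) (auto simp: B_def)
    qed
    moreover have "\<exists>r>0. ball z r \<subseteq> D \<and> sphere_holomorphic_on G (ball z r)" if z: "z \<in> D" for z
    proof -
      obtain i where "z \<in> B i" using cover z by blast
      moreover have "open (B i)" by (simp add: B_def)
      ultimately obtain r where "r > 0" "ball z r \<subseteq> B i" by (meson open_contains_ball)
      then show ?thesis
        using sphere_holomorphic_on_subset[OF G1] \<open>\<And>i. B i \<subseteq> D\<close> by blast
    qed
    note locally_sphere_holomorphic_imp_meromorphic_or_infinite[OF D this]
    ultimately show "\<exists>(r :: nat \<Rightarrow> nat) g. strict_mono r \<and>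
           locally_uniform_spherical_limit D (\<lambda>n. sphere_val (s (r n))) g \<and>
           ((\<exists>\<phi>. \<phi> nicely_meromorphic_on D \<and> (\<forall>z\<in>D. g z = sphere_val \<phi> z)) \<or>
            (\<forall>z\<in>D. g z = None))"
      using k(1) by blast
  qed
qed

section \<open>A Landau-type inequality for functions without simple zeros\<close>

text \<open>
  If \<open>q\<close> were the square of a holomorphic function \<open>u\<close>, then \<open>q' = 2 u u'\<close>, and the estimate
  would be Cauchy's inequality for \<open>u\<close>. The absence of simple zeros is a substitute for the
  existence of the square root: if \<open>q' z0\<close> is large compared with the square root of \<open>q z0\<close>, then
  \<open>q\<close> is close to its linear Taylor polynomial on a disk around \<open>z0\<close> that contains the root of this
  polynomial, and \<open>q'\<close> does not vanish there. So \<open>q\<close> has no zero in the disk, as such a zero would be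
  simple. But on the boundary \<open>norm (q w)\<close> exceeds its value at the centre, which contradicts the
  maximum principle for \<open>1 / q\<close>.
\<close>

lemma deriv_bound_of_no_simple_zeros:
  assumes q: "q holomorphic_on ball z0 \<delta>" and "\<delta> > 0"
    and K: "\<And>w. w \<in> ball z0 \<delta> \<Longrightarrow> norm (q w) \<le> K"
    and zeros: "\<And>w. w \<in> ball z0 \<delta> \<Longrightarrow> q w = 0 \<Longrightarrow> deriv q w = 0"
  shows "(norm (deriv q z0))\<^sup>2 \<le> 96 * K / \<delta>\<^sup>2 * norm (q z0)"
proof (rule ccontr)
  define a b where "a = norm (q z0)" and "b = norm (deriv q z0)"
  assume "\<not> ?thesis"
  then have big: "96 * K / \<delta>\<^sup>2 * a < b\<^sup>2" by (simp add: a_def b_def)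
  have z0: "z0 \<in> ball z0 \<delta>" using \<open>\<delta> > 0\<close> by simp
  have "K \<ge> 0" using K[OF z0] by (meson norm_ge_zero order_trans)
  then have "0 \<le> 96 * K / \<delta>\<^sup>2 * a" by (simp add: a_def)
  then have "b \<noteq> 0" using big by auto
  then have "b > 0" "a > 0" using zeros[OF z0] by (auto simp: a_def b_def)
  then have "K > 0" using K[OF z0] unfolding a_def by linarith
  have hol: "q holomorphic_on cball w (\<delta>/2)" "\<And>v. v \<in> cball w (\<delta>/2) \<Longrightarrow> norm (q v) \<le> K"
    if "w \<in> ball z0 (\<delta>/2)" for w
  proof -
    have "cball w (\<delta>/2) \<subseteq> ball z0 \<delta>"
    proof
      fix v assume "v \<in> cball w (\<delta>/2)"
      then show "v \<in> ball z0 \<delta>" using that dist_triangle[of z0 v w] by simp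
    qed
    then show "q holomorphic_on cball w (\<delta>/2)" "\<And>v. v \<in> cball w (\<delta>/2) \<Longrightarrow> norm (q v) \<le> K"
      using q K holomorphic_on_subset by blast+
  qed
  have cauchy: "norm ((deriv ^^ n) q w) \<le> fact n * K / (\<delta>/2) ^ n"
    if "w \<in> ball z0 (\<delta>/2)" for n w
  proof (rule Cauchy_inequality)
    show "q holomorphic_on ball w (\<delta>/2)"
      by (rule holomorphic_on_subset[OF hol(1)[OF that]]) auto
    show "continuous_on (cball w (\<delta>/2)) q"
      by (rule holomorphic_on_imp_continuous_on[OF hol(1)[OF that]])
    show "norm (q x) \<le> K" if "norm (w - x) = \<delta>/2" for x
      using hol(2)[OF \<open>w \<in> _\<close>] that by (simp add: dist_norm)
  qed (use \<open>\<delta> > 0\<close> in simp)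
  have b_le: "b \<le> 2 * K / \<delta>"
    using cauchy[of z0 1] \<open>\<delta> > 0\<close> by (simp add: b_def mult.commute)
  have q'': "norm (deriv (deriv q) w) \<le> 8 * K / \<delta>\<^sup>2" if "w \<in> ball z0 (\<delta>/2)" for w
    using cauchy[OF that, of 2] by (simp add: numeral_2_eq_2 power2_eq_square)
  \<comment> \<open>three times the distance from z0 to the root of the linear Taylor polynomial\<close>
  define t where "t = 3 * a / b"
  have "t > 0" using \<open>a > 0\<close> \<open>b > 0\<close> by (simp add: t_def)
  have t_le: "t * (32 * K / \<delta>\<^sup>2) < b"
  proof -
    have "t * (32 * K / \<delta>\<^sup>2) = 96 * K / \<delta>\<^sup>2 * a / b" by (simp add: t_def mult_ac)
    also have "\<dots> < b\<^sup>2 / b" using big \<open>b > 0\<close> by (rule divide_strict_right_mono)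
    finally show ?thesis by (simp add: power2_eq_square)
  qed
  have "t < \<delta>/2"
  proof -
    have "t * (32 * K / \<delta>\<^sup>2) < \<delta>/16 * (32 * K / \<delta>\<^sup>2)"
      using t_le b_le \<open>\<delta> > 0\<close> by (simp add: power2_eq_square)
    then have "t < \<delta>/16"
      by (rule mult_right_less_imp_less) (use \<open>K > 0\<close> in simp)
    then show ?thesis using \<open>\<delta> > 0\<close> by simp
  qed
  then have sub: "cball z0 t \<subseteq> ball z0 (\<delta>/2)" "ball z0 (\<delta>/2) \<subseteq> ball z0 \<delta>"
    using \<open>\<delta> > 0\<close> by auto
  have q_at: "(q has_field_derivative deriv q w) (at w within cball z0 t)"
    "(deriv q has_field_derivative deriv (deriv q) w) (at w within cball z0 t)" if "w \<in> cball z0 t" for w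
    using that sub q holomorphic_deriv[OF q]
    by (meson holomorphic_derivI open_ball subsetD)+
  have q': "norm (deriv q w - deriv q z0) \<le> b/4" if "w \<in> cball z0 t" for w
  proof -
    have "norm (deriv q w - deriv q z0) \<le> 8 * K / \<delta>\<^sup>2 * norm (w - z0)"
      by (rule field_differentiable_bound[OF convex_cball[of z0 t] q_at(2) q''])
        (use that sub \<open>t > 0\<close> in auto)
    also have "\<dots> \<le> 8 * K / \<delta>\<^sup>2 * t"
      using that \<open>K > 0\<close> by (intro mult_left_mono) (auto simp: dist_norm norm_minus_commute)
    also have "\<dots> \<le> b/4" using t_le by (simp add: field_simps)
    finally show ?thesis .
  qed
  have nz: "q w \<noteq> 0" if "w \<in> cball z0 t" for w
  proof
    assume "q w = 0"
    then have "deriv q w = 0" using zeros that sub by blast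
    then show False using q'[OF that] \<open>b > 0\<close> by (simp add: b_def)
  qed
  have lin: "norm ((q w - deriv q z0 * w) - (q z0 - deriv q z0 * z0)) \<le> b/4 * norm (w - z0)"
    if "w \<in> cball z0 t" for w
    by (rule field_differentiable_bound[OF convex_cball[of z0 t] _ q' that])
      (use \<open>t > 0\<close> in \<open>auto intro!: derivative_eq_intros q_at\<close>)
  have low: "norm (q w) \<ge> 5/4 * a" if w: "norm (w - z0) = t" for w
  proof -
    have wt: "w \<in> cball z0 t" using w by (simp add: dist_norm norm_minus_commute)
    have "b * t = 3 * a" using \<open>b > 0\<close> by (simp add: t_def)
    have "b * t = norm (deriv q z0 * (w - z0))" by (simp add: norm_mult b_def w)
    also have "deriv q z0 * (w - z0) =
      q w - q z0 - ((q w - deriv q z0 * w) - (q z0 - deriv q z0 * z0))" by (simp add: algebra_simps)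
    also have "norm \<dots> \<le> norm (q w) + a + b/4 * t"
      using lin[OF wt] norm_triangle_ineq4[of "q w - q z0" "(q w - deriv q z0 * w) - (q z0 - deriv q z0 * z0)"]
        norm_triangle_ineq4[of "q w" "q z0"] unfolding w a_def by linarith
    finally show ?thesis using \<open>b * t = 3 * a\<close> by simp
  qed
  have "norm (inverse (q z0)) \<le> inverse (5/4 * a)"
  proof (rule maximum_modulus_frontier[where f = "\<lambda>w. inverse (q w)" and S = "cball z0 t"])
    show "(\<lambda>w. inverse (q w)) holomorphic_on interior (cball z0 t)"
      using nz sub by (intro holomorphic_intros holomorphic_on_subset[OF q]) (force simp: interior_cball)+
    have "continuous_on (cball z0 t) q"
      by (rule holomorphic_on_imp_continuous_on[OF holomorphic_on_subset[OF q]]) (use sub in blast)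
    then show "continuous_on (closure (cball z0 t)) (\<lambda>w. inverse (q w))"
      using nz by (auto intro!: continuous_intros)
    show "norm (inverse (q w)) \<le> inverse (5/4 * a)" if "w \<in> frontier (cball z0 t)" for w
    proof -
      have "norm (w - z0) = t" using that by (simp add: dist_norm norm_minus_commute)
      from low[OF this] show ?thesis
        unfolding norm_inverse using \<open>a > 0\<close> by (intro le_imp_inverse_le) auto
    qed
  qed (use \<open>t > 0\<close> in auto)
  moreover have "norm (inverse (q z0)) = inverse a" by (simp add: norm_inverse a_def)
  ultimately show False using \<open>a > 0\<close> by (simp add: field_simps)
qed

section \<open>From lower to upper bounds of the spherical derivative\<close>

text \<open>
  The poles of a locally injective function are simple, so \<open>1 / f'\<close> has removable singularities
  at them, with value \<open>0\<close>.
\<close>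

definition recip_deriv :: "(complex \<Rightarrow> complex) \<Rightarrow> complex \<Rightarrow> complex" where
  "recip_deriv f z = (if is_pole f z then 0 else inverse (deriv f z))"

text \<open>
  Away from the poles of \<open>f\<close> the function \<open>1 / f'\<close> has no zeros. At a pole, with \<open>g = 1 / f\<close>, it
  equals \<open>- g\<^sup>2 / g'\<close>, where \<open>g'\<close> does not vanish; so its zero there is at least double.
\<close>

lemma recip_deriv_has_derivative:
  assumes f: "f nicely_meromorphic_on D" and D: "open D" "z \<in> D"
    and pos: "spherical_deriv f z > 0"
  shows "\<exists>d. (recip_deriv f has_field_derivative d) (at z) \<and> (recip_deriv f z = 0 \<longrightarrow> d = 0)"
proof (cases "is_pole f z")
  case False
  then have ana: "f analytic_on {z}" using f D by (simp add: nicely_meromorphic_on_imp_analytic_at)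
  have nz: "deriv f z \<noteq> 0" using pos False by (auto simp: spherical_deriv_regular)
  have "\<forall>\<^sub>F w in at z. \<not> is_pole f w"
    using ana by (intro eventually_no_pole analytic_on_imp_meromorphic_on)
  then have "\<forall>\<^sub>F w in nhds z. recip_deriv f w = inverse (deriv f w)"
    using False by (simp add: eventually_nhds_conv_at recip_deriv_def)
      (auto elim: eventually_mono)
  moreover have "(deriv f has_field_derivative deriv (deriv f) z) (at z)"
    using analytic_deriv[OF ana]
    by (simp add: DERIV_deriv_iff_field_differentiable analytic_on_imp_differentiable_at)
  then have "((\<lambda>w. inverse (deriv f w)) has_field_derivative
      - (inverse (deriv f z) * deriv (deriv f) z * inverse (deriv f z))) (at z)"
    using nz by (rule DERIV_inverse')
  ultimately have "(recip_deriv f has_field_derivative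
      - (inverse (deriv f z) * deriv (deriv f) z * inverse (deriv f z))) (at z)"
    by (subst DERIV_cong_ev[OF refl _ refl])
  moreover have "recip_deriv f z \<noteq> 0" using False nz by (simp add: recip_deriv_def)
  ultimately show ?thesis by blast
next
  case True
  define g where "g = (\<lambda>w. inverse (f w))"
  have ana: "g analytic_on {z}" using analytic_at_inverse_pole[OF f D(2) True] by (simp add: g_def)
  have gz: "g z = 0" using is_pole_zero_at_nicely_mero[OF f True D(2)] by (simp add: g_def)
  have "spherical_deriv g z > 0" using pos spherical_deriv_inverse[OF f D] by (simp add: g_def)
  then have nz: "deriv g z \<noteq> 0"
    using analytic_at_imp_no_pole[OF ana] by (auto simp: spherical_deriv_regular)
  have mero: "f meromorphic_on {z}"
    using f D by (auto simp: nicely_meromorphic_on_def intro: meromorphic_on_subset)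
  have "\<forall>\<^sub>F w in at z. recip_deriv f w = - ((g w)\<^sup>2 / deriv g w)"
    using non_zero_neighbour_pole[OF True] eventually_no_pole[OF mero] eventually_at_in_open'[OF D]
  proof eventually_elim
    case (elim w)
    then have "f analytic_on {w}" using f by (simp add: nicely_meromorphic_on_imp_analytic_at)
    then have "deriv g w = - (inverse (f w) * deriv f w * inverse (f w))"
      unfolding g_def using elim
      by (intro DERIV_imp_deriv DERIV_inverse')
        (auto simp: DERIV_deriv_iff_field_differentiable analytic_on_imp_differentiable_at)
    then show ?case using elim by (simp add: recip_deriv_def g_def power2_eq_square field_simps)
  qed
  then have "\<forall>\<^sub>F w in nhds z. recip_deriv f w = - ((g w)\<^sup>2 / deriv g w)"
    using True gz by (simp add: eventually_nhds_conv_at recip_deriv_def)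
  moreover have "(g has_field_derivative deriv g z) (at z)"
    "(deriv g has_field_derivative deriv (deriv g) z) (at z)"
    using ana analytic_deriv[OF ana]
    by (simp_all add: DERIV_deriv_iff_field_differentiable analytic_on_imp_differentiable_at)
  then have "((\<lambda>w. - ((g w)\<^sup>2 / deriv g w)) has_field_derivative 0) (at z)"
    using nz gz by (auto intro!: derivative_eq_intros)
  ultimately have "(recip_deriv f has_field_derivative 0) (at z)"
    by (subst DERIV_cong_ev[OF refl _ refl])
  then show ?thesis by blast
qed

lemma norm_recip_deriv_le:
  "norm (recip_deriv f z) \<le> inverse (spherical_deriv f z)" if "spherical_deriv f z > 0"
proof (cases "is_pole f z")
  case False
  have "1 / norm (deriv f z) \<le> (1 + (norm (f z))\<^sup>2) / norm (deriv f z)"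
    by (rule divide_right_mono) auto
  with False show ?thesis by (simp add: recip_deriv_def spherical_deriv_regular norm_divide inverse_eq_divide)
next
  case True
  then show ?thesis using that by (simp add: recip_deriv_def)
qed

text \<open>
  This is the maximum principle on a disk whose boundary circle lies in the region where the
  bound is assumed.
\<close>

lemma norm_le_if_norm_le_near_boundary:
  assumes q: "q holomorphic_on ball 0 1" and r: "r < 1"
    and B: "\<And>z. r < norm z \<Longrightarrow> norm z < 1 \<Longrightarrow> norm (q z) \<le> B" and z: "z \<in> ball 0 1"
  shows "norm (q z) \<le> B"
proof -
  define \<rho> where "\<rho> = (max r (norm z) + 1) / 2"
  have \<rho>: "r < \<rho>" "norm z < \<rho>" "\<rho> < 1" using z r by (auto simp: \<rho>_def)
  have sub: "cball 0 \<rho> \<subseteq> ball (0::complex) 1" using \<rho> by auto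
  show ?thesis
  proof (rule maximum_modulus_frontier[where f = q and S = "cball 0 \<rho>"])
    show "q holomorphic_on interior (cball 0 \<rho>)"
      using sub interior_subset by (intro holomorphic_on_subset[OF q]) blast
    show "continuous_on (closure (cball 0 \<rho>)) q"
      using holomorphic_on_imp_continuous_on[OF holomorphic_on_subset[OF q sub]] by simp
  qed (use \<rho> B in auto)
qed

text \<open>
  Both \<open>q = 1 / f'\<close> and \<open>p = - f\<^sup>2 / f'\<close>, which is \<open>1 / (1 / f)'\<close>, are bounded by
  \<open>1 / f\<^sup>#\<close>, hence by \<open>1 / \<epsilon>\<close> near the unit circle and then everywhere. The Landau-type inequality
  therefore bounds \<open>norm q' ^ 2\<close> by \<open>L * norm q\<close> and \<open>norm p' ^ 2\<close> by \<open>L * norm p\<close>. Since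
  \<open>p' = - f * (2 + f * q')\<close>, both \<open>norm q'\<close> and \<open>norm (2 + f * q')\<close> are at most the square root
  of \<open>L * norm q\<close>. If \<open>f'\<close> is large, then \<open>q\<close> is small, and these two cannot both be small unless
  \<open>norm f\<close> is large; in numbers, \<open>2\<close> is at most \<open>1 + norm f\<close> times that square root, which bounds \<open>f\<^sup>#\<close> by \<open>L / 2\<close>. Zeros and
  poles are isolated, and the bound extends to them by continuity.
\<close>

lemma spherical_deriv_upper_bound:
  assumes f: "f nicely_meromorphic_on ball 0 1" and "r < 1" "\<epsilon> > 0"
    and pos: "\<And>w. w \<in> ball 0 1 \<Longrightarrow> spherical_deriv f w > 0"
    and low: "\<And>w. r < norm w \<Longrightarrow> norm w < 1 \<Longrightarrow> spherical_deriv f w \<ge> \<epsilon>"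
    and z: "z \<in> ball 0 1"
  shows "spherical_deriv f z \<le> 48 / (\<epsilon> * (1 - norm z)\<^sup>2)"
proof -
  \<comment> \<open>the estimate is needed for f itself and for its inverse\<close>
  have landau: "\<exists>d. (recip_deriv g has_field_derivative d) (at w) \<and>
      (norm d)\<^sup>2 \<le> 96 / (\<epsilon> * (1 - norm w)\<^sup>2) * norm (recip_deriv g w)"
    if g: "g nicely_meromorphic_on ball 0 1"
      and eq: "\<And>w. w \<in> ball 0 1 \<Longrightarrow> spherical_deriv g w = spherical_deriv f w"
      and w: "w \<in> ball 0 1" for g w
  proof -
    have D: "\<exists>d. (recip_deriv g has_field_derivative d) (at v) \<and> (recip_deriv g v = 0 \<longrightarrow> d = 0)"
      if "v \<in> ball 0 1" for v
      using recip_deriv_has_derivative[OF g open_ball that] pos[OF that] eq[OF that] by simp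
    then have hol: "recip_deriv g holomorphic_on ball 0 1"
      unfolding holomorphic_on_open[OF open_ball] by blast
    have zero: "deriv (recip_deriv g) v = 0" if "v \<in> ball 0 1" "recip_deriv g v = 0" for v
      using D[OF that(1)] that(2) DERIV_imp_deriv by blast
    have "norm (recip_deriv g v) \<le> inverse \<epsilon>" if "v \<in> ball 0 1" for v
    proof (rule norm_le_if_norm_le_near_boundary[OF hol \<open>r < 1\<close> _ that])
      fix v :: complex assume v: "r < norm v" "norm v < 1"
      have "norm (recip_deriv g v) \<le> inverse (spherical_deriv g v)"
        using pos[of v] eq[of v] v by (intro norm_recip_deriv_le) simp
      also have "\<dots> \<le> inverse \<epsilon>"
        using low[OF v] eq[of v] v \<open>\<epsilon> > 0\<close> by (intro le_imp_inverse_le) auto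
      finally show "norm (recip_deriv g v) \<le> inverse \<epsilon>" .
    qed
    moreover have sub: "ball w (1 - norm w) \<subseteq> ball 0 1"
      using norm_triangle_ineq2 by (auto simp: dist_norm norm_minus_commute) (smt (verit) norm_triangle_sub)
    ultimately have "(norm (deriv (recip_deriv g) w))\<^sup>2 \<le> 96 * inverse \<epsilon> / (1 - norm w)\<^sup>2 * norm (recip_deriv g w)"
      using w by (intro deriv_bound_of_no_simple_zeros holomorphic_on_subset[OF hol] zero) auto
    moreover have "(recip_deriv g has_field_derivative deriv (recip_deriv g) w) (at w)"
      using hol w holomorphic_derivI by blast
    moreover have "96 * inverse \<epsilon> / (1 - norm w)\<^sup>2 = 96 / (\<epsilon> * (1 - norm w)\<^sup>2)"
      by (simp add: field_simps)
    ultimately show ?thesis by auto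
  qed
  define g where "g = (\<lambda>w. inverse (f w))"
  have ng: "g nicely_meromorphic_on ball 0 1"
    unfolding g_def by (rule nicely_meromorphic_on_inverse[OF f])
  have eq: "spherical_deriv g w = spherical_deriv f w" if "w \<in> ball 0 1" for w
    unfolding g_def by (rule spherical_deriv_inverse[OF f open_ball that])
  have regular: "spherical_deriv f w \<le> 48 / (\<epsilon> * (1 - norm w)\<^sup>2)"
    if w: "w \<in> ball 0 1" and np: "\<not> is_pole f w" and nz: "f w \<noteq> 0" for w
  proof -
    define L where "L = 96 / (\<epsilon> * (1 - norm w)\<^sup>2)"
    have L: "L > 0" using w \<open>\<epsilon> > 0\<close> by (simp add: L_def)
    have ana: "f analytic_on {w}" using f w np by (simp add: nicely_meromorphic_on_imp_analytic_at)
    have f': "deriv f w \<noteq> 0" using pos[OF w] np by (auto simp: spherical_deriv_regular)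
    obtain d where d: "(recip_deriv f has_field_derivative d) (at w)"
      "(norm d)\<^sup>2 \<le> L * norm (recip_deriv f w)"
      using landau[OF f refl w] by (auto simp: L_def)
    obtain e where e: "(recip_deriv g has_field_derivative e) (at w)"
      "(norm e)\<^sup>2 \<le> L * norm (recip_deriv g w)"
      using landau[OF ng eq w] by (auto simp: L_def)
    have mero: "f meromorphic_on {w}" using ana by (rule analytic_on_imp_meromorphic_on)
    have "\<forall>\<^sub>F v in at w. \<not> is_pole f v \<and> f v \<noteq> 0 \<and> v \<in> ball 0 1"
      using eventually_no_pole[OF mero] eventually_at_in_open'[OF open_ball w]
        tendsto_imp_eventually_ne[OF isContD[OF analytic_at_imp_isCont[OF ana]] nz]
      by eventually_elim blast
    then have ev: "\<forall>\<^sub>F v in nhds w. \<not> is_pole f v \<and> f v \<noteq> 0 \<and> v \<in> ball 0 1"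
      using np nz w by (simp add: eventually_nhds_conv_at)
    have "\<forall>\<^sub>F v in nhds w. recip_deriv g v = - ((f v)\<^sup>2 * recip_deriv f v)"
      using ev
    proof eventually_elim
      case (elim v)
      then have ana: "f analytic_on {v}" using f by (simp add: nicely_meromorphic_on_imp_analytic_at)
      then have "deriv g v = - (inverse (f v) * deriv f v * inverse (f v))"
        unfolding g_def using elim
        by (intro DERIV_imp_deriv DERIV_inverse')
          (auto simp: DERIV_deriv_iff_field_differentiable analytic_on_imp_differentiable_at)
      moreover have "\<not> is_pole g v"
        unfolding g_def using ana elim by (intro analytic_at_imp_no_pole analytic_intros) auto
      ultimately show ?case
        using elim by (simp add: recip_deriv_def power2_eq_square)
    qed
    note ev' = this
    have gw: "recip_deriv g w = - ((f w)\<^sup>2 * recip_deriv f w)"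
      using eventually_nhds_x_imp_x[OF ev'] .
    have fd: "(f has_field_derivative deriv f w) (at w)"
      using ana by (simp add: DERIV_deriv_iff_field_differentiable analytic_on_imp_differentiable_at)
    have rf: "recip_deriv f w = inverse (deriv f w)" using np by (simp add: recip_deriv_def)
    have "((\<lambda>v. - ((f v)\<^sup>2 * recip_deriv f v)) has_field_derivative - (f w * (2 + f w * d))) (at w)"
      using f' by (auto intro!: derivative_eq_intros fd d simp: rf power2_eq_square algebra_simps)
    then have "(recip_deriv g has_field_derivative - (f w * (2 + f w * d))) (at w)"
      by (subst DERIV_cong_ev[OF refl ev' refl])
    then have e_eq: "e = - (f w * (2 + f w * d))" using e(1) DERIV_unique by blast
    define m where "m = sqrt (L * norm (recip_deriv f w))"
    have m: "m \<ge> 0" "m\<^sup>2 = L * norm (recip_deriv f w)" using L by (simp_all add: m_def)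
    have "(norm (f w) * norm (2 + f w * d))\<^sup>2 \<le> (norm (f w) * m)\<^sup>2"
      using e(2) unfolding e_eq gw by (simp add: norm_mult norm_power power_mult_distrib m mult_ac)
    then have "norm (f w) * norm (2 + f w * d) \<le> norm (f w) * m"
      by (rule power2_le_imp_le) (simp add: m)
    then have 1: "norm (2 + f w * d) \<le> m" using nz by simp
    have 2: "norm d \<le> m" using d(2) unfolding m(2)[symmetric] by (rule power2_le_imp_le) (rule m(1))
    have "2 \<le> norm (2 + f w * d) + norm (f w * d)"
      using norm_triangle_ineq4[of "2 + f w * d" "f w * d"] by simp
    also have "\<dots> \<le> m + norm (f w) * m"
      using 1 2 by (simp add: norm_mult mult_left_mono add_mono)
    finally have "2\<^sup>2 \<le> (m * (1 + norm (f w)))\<^sup>2"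
      by (intro power_mono) (auto simp: algebra_simps)
    also have "\<dots> \<le> m\<^sup>2 * (2 * (1 + (norm (f w))\<^sup>2))"
      unfolding power_mult_distrib
    proof (rule mult_left_mono)
      have "0 \<le> (1 - norm (f w))\<^sup>2" by simp
      then show "(1 + norm (f w))\<^sup>2 \<le> 2 * (1 + (norm (f w))\<^sup>2)" by (simp add: power2_eq_square algebra_simps)
    qed simp
    also have "\<dots> = 2 * L / spherical_deriv f w"
      unfolding m rf spherical_deriv_regular[OF np] norm_inverse by (simp add: divide_inverse mult_ac)
    finally have "spherical_deriv f w \<le> L / 2"
      using pos[OF w] by (simp add: field_simps)
    then show ?thesis by (simp add: L_def)
  qed
  have cont: "(spherical_deriv f \<longlongrightarrow> spherical_deriv f z) (at z)"
    using continuous_on_spherical_deriv[OF f open_ball] z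
    by (simp add: continuous_on_eq_continuous_at isCont_def)
  have lim: "((\<lambda>w. 48 / (\<epsilon> * (1 - norm w)\<^sup>2)) \<longlongrightarrow> 48 / (\<epsilon> * (1 - norm z)\<^sup>2)) (at z)"
    using z \<open>\<epsilon> > 0\<close> by (intro tendsto_intros) auto
  have ev_in: "\<forall>\<^sub>F w in at z. w \<in> ball 0 1" by (rule eventually_at_in_open'[OF open_ball z])
  have ev_np: "\<forall>\<^sub>F w in at z. \<not> is_pole f w"
    using f z by (intro eventually_no_pole) (auto simp: nicely_meromorphic_on_def intro: meromorphic_on_subset)
  have ev_nz: "\<forall>\<^sub>F w in at z. f w \<noteq> 0"
  proof (cases "is_pole f z")
    case True
    then show ?thesis by (rule non_zero_neighbour_pole)
  next
    case False
    then have ana: "f analytic_on {z}" using f z by (simp add: nicely_meromorphic_on_imp_analytic_at)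
    have "deriv f z \<noteq> 0" using pos[OF z] False by (auto simp: spherical_deriv_regular)
    show ?thesis
    proof (rule ccontr)
      assume ev: "\<not> ?thesis"
      then have "\<not> isolated_zero f z" by (auto simp: isolated_zero_def)
      moreover have "f z = 0"
        using ev tendsto_imp_eventually_ne[OF isContD[OF analytic_at_imp_isCont[OF ana]]] by blast
      ultimately have "\<forall>\<^sub>F w in nhds z. f w = 0"
        using non_isolated_zero_imp_eventually_zero[OF ana] by (simp add: eventually_nhds_conv_at)
      then have "deriv f z = deriv (\<lambda>_. 0) z" by (intro deriv_cong_ev) auto
      with \<open>deriv f z \<noteq> 0\<close> show False by simp
    qed
  qed
  have "\<forall>\<^sub>F w in at z. spherical_deriv f w \<le> 48 / (\<epsilon> * (1 - norm w)\<^sup>2)"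
    using ev_in ev_np ev_nz by eventually_elim (rule regular)
  then show ?thesis by (rule tendsto_le[OF _ lim cont, rotated]) simp
qed

text \<open>
  A sequence along which \<open>h\<close> tends to \<open>0\<close> and the modulus to \<open>1\<close> would accumulate at a point of the
  unit circle, against the positive limes inferior there.
\<close>

lemma bounded_below_near_boundary:
  fixes h :: "complex \<Rightarrow> real"
  assumes "\<And>\<zeta>. \<zeta> \<in> sphere 0 1 \<Longrightarrow> 0 < Liminf (at \<zeta> within ball 0 1) (\<lambda>z. ereal (h z))"
  shows "\<exists>r<1. \<exists>\<epsilon>>0. \<forall>z. r < norm z \<and> norm z < 1 \<longrightarrow> \<epsilon> \<le> h z"
proof (rule ccontr)
  assume neg: "\<not> ?thesis"
  have "\<exists>z. 1 - inverse (real (Suc n)) < norm z \<and> norm z < 1 \<and> h z < inverse (real (Suc n))" for n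
  proof -
    have "1 - inverse (real (Suc n)) < 1" "inverse (real (Suc n)) > 0" by simp_all
    with neg show ?thesis by (meson not_le)
  qed
  then obtain z where z: "\<And>n. 1 - inverse (real (Suc n)) < norm (z n)" "\<And>n. norm (z n) < 1"
    "\<And>n. h (z n) < inverse (real (Suc n))" by metis
  have "\<forall>n. z n \<in> cball 0 1" using z(2) by (simp add: less_imp_le)
  then obtain \<zeta> k where k: "strict_mono (k :: nat \<Rightarrow> nat)" and lim: "(z \<circ> k) \<longlonglongrightarrow> \<zeta>"
    using compact_cball[of "0::complex" 1] unfolding compact_def by blast
  have inv: "(\<lambda>n. inverse (real (Suc (k n)))) \<longlonglongrightarrow> 0"
    using LIMSEQ_subseq_LIMSEQ[OF LIMSEQ_inverse_real_of_nat k] by (simp add: o_def)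
  have "(\<lambda>n. norm (z (k n))) \<longlonglongrightarrow> 1"
  proof (rule tendsto_sandwich)
    show "(\<lambda>n. 1 - inverse (real (Suc (k n)))) \<longlonglongrightarrow> 1"
      using tendsto_diff[OF tendsto_const[of 1] inv] by simp
    show "(\<lambda>n. 1::real) \<longlonglongrightarrow> 1" by simp
  qed (use z in \<open>auto intro!: always_eventually less_imp_le\<close>)
  moreover have "(\<lambda>n. norm (z (k n))) \<longlonglongrightarrow> norm \<zeta>"
    using tendsto_norm[OF lim] by (simp add: o_def)
  ultimately have \<zeta>: "norm \<zeta> = 1" using LIMSEQ_unique by blast
  then have "0 < Liminf (at \<zeta> within ball 0 1) (\<lambda>z. ereal (h z))" using assms by simp
  then obtain c where c: "0 < ereal c" "ereal c < Liminf (at \<zeta> within ball 0 1) (\<lambda>z. ereal (h z))"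
    using ereal_dense2 by blast
  then have "\<forall>\<^sub>F w in at \<zeta> within ball 0 1. c < h w"
    using less_LiminfD[OF c(2)] by simp
  moreover have "filterlim (z \<circ> k) (at \<zeta> within ball 0 1) sequentially"
    unfolding filterlim_at using lim z(2) \<zeta> by (auto intro!: always_eventually simp: less_le)
  ultimately have "\<forall>\<^sub>F n in sequentially. c < h ((z \<circ> k) n)" by (rule eventually_compose_filterlim)
  moreover have "\<forall>\<^sub>F n in sequentially. inverse (real (Suc (k n))) < c"
    using order_tendstoD(2)[OF inv] c(1) by simp
  ultimately have "\<forall>\<^sub>F n in sequentially. False"
    by eventually_elim (use z(3) in \<open>fastforce dest: order_less_trans\<close>)
  then show False by simp
qed

theorem corollary5:
  fixes h :: "complex \<Rightarrow> real"
  assumes "continuous_on (ball 0 1) h"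
    and "\<And>z. z \<in> ball 0 1 \<Longrightarrow> 0 \<le> h z"
    and "\<And>\<zeta>. \<zeta> \<in> sphere 0 1 \<Longrightarrow> 0 < Liminf (at \<zeta> within ball 0 1) (\<lambda>z. ereal (h z))"
  shows "normal_family_on
           {f. f nicely_meromorphic_on ball 0 1 \<and> (\<forall>z\<in>ball 0 1. spherical_deriv f z \<noteq> h z)}
           (ball 0 1)"
proof (rule Marty_normality_criterion)
  obtain r \<epsilon> where r: "r < 1" "\<epsilon> > 0" and low: "\<And>z. r < norm z \<Longrightarrow> norm z < 1 \<Longrightarrow> \<epsilon> \<le> h z"
    using bounded_below_near_boundary[of h] assms(3) by metis
  fix z :: complex assume z: "z \<in> ball 0 1"
  define s where "s = (1 - norm z) / 2"
  have s: "s > 0" using z by (simp add: s_def)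
  have near: "norm w < 1 - s" if "w \<in> ball z s" for w
    using that norm_triangle_sub[of w z] by (simp add: s_def dist_norm norm_minus_commute field_simps)
  have "compact (h ` cball 0 (1 - s))"
    using s by (intro compact_continuous_image continuous_on_subset[OF assms(1)]) auto
  then obtain M where M: "\<forall>w \<in> cball 0 (1 - s). \<bar>h w\<bar> \<le> M"
    by (auto dest!: compact_imp_bounded simp: bounded_iff)
  have "spherical_deriv f w \<le> max M (48 / (\<epsilon> * s\<^sup>2))"
    if f: "f nicely_meromorphic_on ball 0 1" and avoid: "\<And>z. z \<in> ball 0 1 \<Longrightarrow> spherical_deriv f z \<noteq> h z"
      and w: "w \<in> ball z s" for f w
  proof -
    have wD: "w \<in> ball 0 1" using near[OF w] s by simp
    show ?thesis
    proof (cases "spherical_deriv f w \<le> h w")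
      case True
      moreover have "h w \<le> M" using M near[OF w] by (auto dest!: bspec[of _ _ w])
      ultimately show ?thesis by simp
    next
      case False
      \<comment> \<open>the difference is continuous and has no zero in the connected disk, so it has constant sign\<close>
      have above: "spherical_deriv f v > h v" if v: "v \<in> ball 0 1" for v
      proof (rule ccontr)
        assume neg: "\<not> spherical_deriv f v > h v"
        define u where "u v = spherical_deriv f v - h v" for v
        have "continuous_on (ball 0 1) u"
          unfolding u_def by (intro continuous_intros continuous_on_spherical_deriv[OF f] assms(1)) auto
        then have "connected (u ` ball 0 1)" by (intro connected_continuous_image) auto
        moreover have "u v \<in> u ` ball 0 1" "u w \<in> u ` ball 0 1" using v wD by blast+
        moreover have "u v \<le> 0" "0 \<le> u w" using False neg by (auto simp: u_def)
        ultimately have "0 \<in> u ` ball 0 1" by (meson connectedD_interval)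
        then show False using avoid by (auto simp: u_def)
      qed
      have "spherical_deriv f w \<le> 48 / (\<epsilon> * (1 - norm w)\<^sup>2)"
      proof (rule spherical_deriv_upper_bound[OF f r _ _ wD])
        show "spherical_deriv f v > 0" if "v \<in> ball 0 1" for v
          using above[OF that] assms(2)[OF that] by simp
        show "\<epsilon> \<le> spherical_deriv f v" if "r < norm v" "norm v < 1" for v
          using above[of v] low[OF that] that by simp
      qed
      also have "\<dots> \<le> 48 / (\<epsilon> * s\<^sup>2)"
        using near[OF w] s r by (intro divide_left_mono mult_left_mono power_mono mult_pos_pos) auto
      finally show ?thesis by simp
    qed
  qed
  then show "\<exists>r>0. \<exists>M. \<forall>f\<in>{f. f nicely_meromorphic_on ball 0 1 \<and> (\<forall>z\<in>ball 0 1. spherical_deriv f z \<noteq> h z)}.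
      \<forall>w\<in>ball 0 1 \<inter> ball z r. spherical_deriv f w \<le> M"
    using s by blast
qed auto

end
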